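(* Let $A$ be a commutative ring, $\mathcal{W}$ a set of ideals of $A$, $I\in\mathcal{W}$ and $N\subseteq M$ two $A$-modules. Then $$s(N,M;\{I\})\leq \mathrm{rt}(I;M/N)\leq \max\bigl(\mathrm{rt}(I;M),\,s(N,M;\{I\})\bigr).$$ In particular, $s(N,M;\mathcal{W})\leq \sup\{\mathrm{rt}(J;M/N)\mid J\in\mathcal{W}\}$ and $s(N,M)\leq \mathrm{grt}(M/N)$.
   Context: All rings are commutative with unity; tensor products are over $A$. All the quantities below take values in $\{1,2,3,\dots\}\cup\{\infty\}$ (a minimum over the empty set is $\infty$). Strong uniform number: for $A$-modules $N\subseteq M$ and a set $\mathcal{W}$ of ideals of $A$, $s(N,M;\mathcal{W})$ is the minimum of the integers $s\geq 1$ such that $I^{n}M\cap N=I^{n-s}(I^{s}M\cap N)$ for every $I\in\mathcal{W}$ and every $n\geq s$. If $\mathcal{W}$ is the set of all ideals of $A$, write $s(N,M)=s(N,M;\mathcal{W})$. Relation type: for an ideal $I$ of $A$ and an $A$-module $M$, let $\mathcal{R}(I;M)=\bigoplus_{n\geq 0}I^{n}M$ be the Rees module, let $\mathbf{S}(I)$ be the symmetric algebra of the $A$-module $I$, and let $\gamma:\mathbf{S}(I)\otimes M\to\mathcal{R}(I;M)$ be the natural surjective graded morphism ($M$ in degree $0$; $(x_1\cdots x_n)\otimes m\mapsto x_1\cdots x_n m$ for $x_i\in I$). For $n\geq 1$ put $E(I;M)_n=\ker\gamma_n/\bigl(\mathbf{S}_1(I)\cdot\ker\gamma_{n-1}\bigr)$,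 where $\mathbf{S}_1(I)=I$. The relation type of $I$ with respect to $M$ is $\mathrm{rt}(I;M)=\min\{r\geq 1\mid E(I;M)_n=0 \text{ for all } n\geq r+1\}$. Global relation type: $\mathrm{grt}(M)=\sup\{\mathrm{rt}(I;M)\mid I \text{ an ideal of } A\}$. *)

theory Defs
  imports "HOL-Library.Multiset" "HOL-Library.Extended_Nat"
    "HOL-Algebra.Module" "HOL-Algebra.QuotRing" "HOL-Algebra.Ideal_Product"
begin

hide_const (open) Multiset.mult

section \<open>Generated submodules, quotients, free modules\<close>

text \<open>The fields \<^const>\<open>mult\<close> and \<^const>\<open>one\<close> of a module record
  carry no information unless the record is used as an algebra.\<close>

definition submodule_gen ::
    "('a, 'r) ring_scheme \<Rightarrow> ('a, 'm, 'd) module_scheme \<Rightarrow> 'm set \<Rightarrow> 'm set"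
  where "submodule_gen R M S = \<Inter>{H. submodule H R M \<and> S \<subseteq> H}"

text \<open>\<^const>\<open>FactRing\<close> together with the induced scalar multiplication: the quotient module
  \<open>M/N\<close> of a module, and also the quotient algebra when \<open>N\<close> is an ideal of an algebra \<open>M\<close>.\<close>

definition fact_module :: "('a, 'm, 'd) module_scheme \<Rightarrow> 'm set \<Rightarrow> ('a, 'm set) module"
  where "fact_module M N =
    ring.extend (M Quot N) (module.fields (\<lambda>a X. \<Union>x\<in>X. N +>\<^bsub>M\<^esub> (a \<odot>\<^bsub>M\<^esub> x)))"

definition free_module :: "('a, 'r) ring_scheme \<Rightarrow> 'x set \<Rightarrow> ('a, 'x \<Rightarrow> 'a) module"
  where "free_module R X =
    \<lparr>carrier = {f. (\<forall>x. f x \<in> carrier R) \<and> finite {x. f x \<noteq> \<zero>\<^bsub>R\<^esub>} \<and> {x. f x \<noteq> \<zero>\<^bsub>R\<^esub>} \<subseteq> X},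
     mult = undefined, one = undefined,
     zero = (\<lambda>_. \<zero>\<^bsub>R\<^esub>), add = (\<lambda>f g x. f x \<oplus>\<^bsub>R\<^esub> g x),
     smult = (\<lambda>a f x. a \<otimes>\<^bsub>R\<^esub> f x)\<rparr>"

definition free_gen :: "('a, 'r) ring_scheme \<Rightarrow> 'x \<Rightarrow> 'x \<Rightarrow> 'a"
  where "free_gen R x = (\<lambda>y. if y = x then \<one>\<^bsub>R\<^esub> else \<zero>\<^bsub>R\<^esub>)"


section \<open>Tensor products\<close>

definition tensor_rels ::
    "('a, 'r) ring_scheme \<Rightarrow> ('a, 'p, 'c) module_scheme \<Rightarrow> ('a, 'm, 'd) module_scheme
      \<Rightarrow> ('p \<times> 'm \<Rightarrow> 'a) set"
  where "tensor_rels R P M =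
    (let F = free_module R (carrier P \<times> carrier M); d = free_gen R in
      {d (x \<oplus>\<^bsub>P\<^esub> x', y) \<ominus>\<^bsub>F\<^esub> (d (x, y) \<oplus>\<^bsub>F\<^esub> d (x', y)) | x x' y.
          x \<in> carrier P \<and> x' \<in> carrier P \<and> y \<in> carrier M}
    \<union> {d (x, y \<oplus>\<^bsub>M\<^esub> y') \<ominus>\<^bsub>F\<^esub> (d (x, y) \<oplus>\<^bsub>F\<^esub> d (x, y')) | x y y'.
          x \<in> carrier P \<and> y \<in> carrier M \<and> y' \<in> carrier M}
    \<union> {d (a \<odot>\<^bsub>P\<^esub> x, y) \<ominus>\<^bsub>F\<^esub> (a \<odot>\<^bsub>F\<^esub> d (x, y)) | a x y.
          a \<in> carrier R \<and> x \<in> carrier P \<and> y \<in> carrier M}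
    \<union> {d (x, a \<odot>\<^bsub>M\<^esub> y) \<ominus>\<^bsub>F\<^esub> (a \<odot>\<^bsub>F\<^esub> d (x, y)) | a x y.
          a \<in> carrier R \<and> x \<in> carrier P \<and> y \<in> carrier M})"

definition tensor_submodule ::
    "('a, 'r) ring_scheme \<Rightarrow> ('a, 'p, 'c) module_scheme \<Rightarrow> ('a, 'm, 'd) module_scheme
      \<Rightarrow> ('p \<times> 'm \<Rightarrow> 'a) set"
  where "tensor_submodule R P M =
    submodule_gen R (free_module R (carrier P \<times> carrier M)) (tensor_rels R P M)"

definition tensor ::
    "('a, 'r) ring_scheme \<Rightarrow> ('a, 'p, 'c) module_scheme \<Rightarrow> ('a, 'm, 'd) module_scheme
      \<Rightarrow> ('a, ('p \<times> 'm \<Rightarrow> 'a) set) module"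
  where "tensor R P M =
    fact_module (free_module R (carrier P \<times> carrier M)) (tensor_submodule R P M)"

definition pure_tensor ::
    "('a, 'r) ring_scheme \<Rightarrow> ('a, 'p, 'c) module_scheme \<Rightarrow> ('a, 'm, 'd) module_scheme
      \<Rightarrow> 'p \<Rightarrow> 'm \<Rightarrow> ('p \<times> 'm \<Rightarrow> 'a) set"
  where "pure_tensor R P M x y =
    tensor_submodule R P M +>\<^bsub>free_module R (carrier P \<times> carrier M)\<^esub> free_gen R (x, y)"

text \<open>For a bilinear map \<open>b\<close> into \<open>Q\<close>, the linear map with \<open>x \<otimes> y \<mapsto> b x y\<close>: a class of formal
  linear combinations is sent to the common value of the corresponding combinations in \<open>Q\<close>.\<close>

definition tensor_lift ::
    "('a, 'r) ring_scheme \<Rightarrow> ('a, 'q, 'e) module_scheme \<Rightarrow> ('p \<Rightarrow> 'm \<Rightarrow> 'q)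
      \<Rightarrow> ('p \<times> 'm \<Rightarrow> 'a) set \<Rightarrow> 'q"
  where "tensor_lift R Q b Z =
    the_elem ((\<lambda>f. \<Oplus>\<^bsub>Q\<^esub>p\<in>{p. f p \<noteq> \<zero>\<^bsub>R\<^esub>}. f p \<odot>\<^bsub>Q\<^esub> b (fst p) (snd p)) ` Z)"


section \<open>The symmetric algebra of a module\<close>

text \<open>The polynomial algebra \<open>R[T\<^sub>x | x \<in> X]\<close>; a multiset over \<open>X\<close> stands for a monomial.\<close>

definition poly_algebra :: "('a, 'r) ring_scheme \<Rightarrow> 'x set \<Rightarrow> ('a, 'x multiset \<Rightarrow> 'a) module"
  where "poly_algebra R X =
    (free_module R {m. set_mset m \<subseteq> X})
      \<lparr>mult := (\<lambda>p q m. \<Oplus>\<^bsub>R\<^esub>k\<in>{k. k \<subseteq># m}. p k \<otimes>\<^bsub>R\<^esub> q (m - k)),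
       one := free_gen R {#}\<rparr>"

text \<open>The symmetric algebra is the polynomial algebra on the elements of \<open>M\<close> modulo the relations
  making \<open>x \<mapsto> T\<^sub>x\<close> linear.\<close>

definition sym_rels ::
    "('a, 'r) ring_scheme \<Rightarrow> ('a, 'm, 'd) module_scheme \<Rightarrow> ('m multiset \<Rightarrow> 'a) set"
  where "sym_rels R M =
    (let P = poly_algebra R (carrier M); T = (\<lambda>x. free_gen R {#x#}) in
      {T (x \<oplus>\<^bsub>M\<^esub> y) \<ominus>\<^bsub>P\<^esub> (T x \<oplus>\<^bsub>P\<^esub> T y) | x y. x \<in> carrier M \<and> y \<in> carrier M}
    \<union> {T (a \<odot>\<^bsub>M\<^esub> x) \<ominus>\<^bsub>P\<^esub> (a \<odot>\<^bsub>P\<^esub> T x) | a x. a \<in> carrier R \<and> x \<in> carrier M})"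

definition sym_ideal ::
    "('a, 'r) ring_scheme \<Rightarrow> ('a, 'm, 'd) module_scheme \<Rightarrow> ('m multiset \<Rightarrow> 'a) set"
  where "sym_ideal R M = Idl\<^bsub>poly_algebra R (carrier M)\<^esub> (sym_rels R M)"

definition sym_algebra ::
    "('a, 'r) ring_scheme \<Rightarrow> ('a, 'm, 'd) module_scheme
      \<Rightarrow> ('a, ('m multiset \<Rightarrow> 'a) set) module"
  where "sym_algebra R M = fact_module (poly_algebra R (carrier M)) (sym_ideal R M)"

definition sym_degree ::
    "('a, 'r) ring_scheme \<Rightarrow> ('a, 'm, 'd) module_scheme \<Rightarrow> nat
      \<Rightarrow> ('a, ('m multiset \<Rightarrow> 'a) set) module"
  where "sym_degree R M n = (sym_algebra R M)
    \<lparr>carrier := {sym_ideal R M +>\<^bsub>poly_algebra R (carrier M)\<^esub> p | p.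
        p \<in> carrier (poly_algebra R (carrier M)) \<and> (\<forall>m. p m \<noteq> \<zero>\<^bsub>R\<^esub> \<longrightarrow> size m = n)}\<rparr>"

definition ideal_module :: "('a, 'r) ring_scheme \<Rightarrow> 'a set \<Rightarrow> ('a, 'a) module"
  where "ideal_module R I =
    \<lparr>carrier = I, mult = mult R, one = one R, zero = zero R, add = add R, smult = mult R\<rparr>"

text \<open>The algebra morphism \<open>S(I) \<rightarrow> R\<close> extending the inclusion \<open>I \<subseteq> R\<close>, i.e. evaluation \<open>T\<^sub>x \<mapsto> x\<close>;
  it sends the product \<open>x\<^sub>1 \<cdots> x\<^sub>n\<close> formed in \<open>S(I)\<close> to the product formed in \<open>R\<close>.\<close>

definition sym_eval :: "('a, 'r) ring_scheme \<Rightarrow> ('a multiset \<Rightarrow> 'a) set \<Rightarrow> 'a"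
  where "sym_eval R Z =
    the_elem ((\<lambda>p. \<Oplus>\<^bsub>R\<^esub>m\<in>{m. p m \<noteq> \<zero>\<^bsub>R\<^esub>}.
        p m \<otimes>\<^bsub>R\<^esub> (\<Otimes>\<^bsub>R\<^esub>x\<in>set_mset m. x [^]\<^bsub>R\<^esub> count m x)) ` Z)"


section \<open>Strong uniform numbers\<close>

definition ideal_smult ::
    "('a, 'r) ring_scheme \<Rightarrow> ('a, 'm, 'd) module_scheme \<Rightarrow> 'a set \<Rightarrow> 'm set \<Rightarrow> 'm set"
  where "ideal_smult R M J X = submodule_gen R M {a \<odot>\<^bsub>M\<^esub> x | a x. a \<in> J \<and> x \<in> X}"

text \<open>Here \<open>I [^]\<^bsub>ideals_set R\<^esub> n\<close> is the ideal power, with \<open>I\<^sup>0 = R\<close>.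
  In \<^typ>\<open>enat\<close> the infimum of the empty set is \<open>\<infinity>\<close>.\<close>

definition strong_uniform_number ::
    "('a, 'r) ring_scheme \<Rightarrow> 'm set \<Rightarrow> ('a, 'm, 'd) module_scheme \<Rightarrow> 'a set set \<Rightarrow> enat"
  where "strong_uniform_number R N M W =
    (INF s\<in>{s::nat. 1 \<le> s \<and> (\<forall>I\<in>W. \<forall>n\<ge>s.
        ideal_smult R M (I [^]\<^bsub>ideals_set R\<^esub> n) (carrier M) \<inter> N =
        ideal_smult R M (I [^]\<^bsub>ideals_set R\<^esub> (n - s))
          (ideal_smult R M (I [^]\<^bsub>ideals_set R\<^esub> s) (carrier M) \<inter> N))}. enat s)"

definition strong_uniform_number_all ::
    "('a, 'r) ring_scheme \<Rightarrow> 'm set \<Rightarrow> ('a, 'm, 'd) module_scheme \<Rightarrow> enat"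
  where "strong_uniform_number_all R N M = strong_uniform_number R N M {I. ideal I R}"


section \<open>Relation type\<close>

text \<open>Graded modules and graded morphisms are given by their homogeneous components:
  \<open>rees R I M n\<close> is \<open>I\<^sup>n M\<close>, \<open>sym_tensor R I M n\<close> is \<open>S\<^sub>n(I) \<otimes> M\<close>, and \<open>rees_map R I M n\<close> is
  \<open>\<gamma>\<^sub>n : S\<^sub>n(I) \<otimes> M \<rightarrow> I\<^sup>n M\<close>.\<close>

definition rees ::
    "('a, 'r) ring_scheme \<Rightarrow> 'a set \<Rightarrow> ('a, 'm, 'd) module_scheme \<Rightarrow> nat
      \<Rightarrow> ('a, 'm, 'd) module_scheme"
  where "rees R I M n =
    M\<lparr>carrier := ideal_smult R M (I [^]\<^bsub>ideals_set R\<^esub> n) (carrier M)\<rparr>"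

definition sym_tensor ::
    "('a, 'r) ring_scheme \<Rightarrow> 'a set \<Rightarrow> ('a, 'm, 'd) module_scheme \<Rightarrow> nat
      \<Rightarrow> ('a, (('a multiset \<Rightarrow> 'a) set \<times> 'm \<Rightarrow> 'a) set) module"
  where "sym_tensor R I M n = tensor R (sym_degree R (ideal_module R I) n) M"

definition rees_map ::
    "('a, 'r) ring_scheme \<Rightarrow> 'a set \<Rightarrow> ('a, 'm, 'd) module_scheme \<Rightarrow> nat
      \<Rightarrow> (('a multiset \<Rightarrow> 'a) set \<times> 'm \<Rightarrow> 'a) set \<Rightarrow> 'm"
  where "rees_map R I M n = tensor_lift R (rees R I M n) (\<lambda>s y. sym_eval R s \<odot>\<^bsub>M\<^esub> y)"

definition rees_ker ::
    "('a, 'r) ring_scheme \<Rightarrow> 'a set \<Rightarrow> ('a, 'm, 'd) module_scheme \<Rightarrow> nat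
      \<Rightarrow> (('a multiset \<Rightarrow> 'a) set \<times> 'm \<Rightarrow> 'a) set set"
  where "rees_ker R I M n = a_kernel (sym_tensor R I M n) (rees R I M n) (rees_map R I M n)"

text \<open>For \<open>s\<close> of degree 1, the multiplication \<open>S\<^sub>n(I) \<otimes> M \<rightarrow> S\<^sub>n\<^sub>+\<^sub>1(I) \<otimes> M\<close>,
  \<open>t \<otimes> y \<mapsto> s t \<otimes> y\<close>.\<close>

definition sym_act ::
    "('a, 'r) ring_scheme \<Rightarrow> 'a set \<Rightarrow> ('a, 'm, 'd) module_scheme \<Rightarrow> nat
      \<Rightarrow> ('a multiset \<Rightarrow> 'a) set
      \<Rightarrow> (('a multiset \<Rightarrow> 'a) set \<times> 'm \<Rightarrow> 'a) set \<Rightarrow> (('a multiset \<Rightarrow> 'a) set \<times> 'm \<Rightarrow> 'a) set"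
  where "sym_act R I M n s =
    tensor_lift R (sym_tensor R I M (Suc n))
      (\<lambda>t y. pure_tensor R (sym_degree R (ideal_module R I) (Suc n)) M
        (s \<otimes>\<^bsub>sym_algebra R (ideal_module R I)\<^esub> t) y)"

text \<open>\<open>E(I;M)\<^sub>n\<close>, meaningful for \<open>n \<ge> 1\<close>.\<close>

definition effective_relations ::
    "('a, 'r) ring_scheme \<Rightarrow> 'a set \<Rightarrow> ('a, 'm, 'd) module_scheme \<Rightarrow> nat
      \<Rightarrow> ('a, (('a multiset \<Rightarrow> 'a) set \<times> 'm \<Rightarrow> 'a) set set) module"
  where "effective_relations R I M n =
    fact_module ((sym_tensor R I M n)\<lparr>carrier := rees_ker R I M n\<rparr>)
      (submodule_gen R (sym_tensor R I M n)
        {sym_act R I M (n - 1) s z | s z.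
          s \<in> carrier (sym_degree R (ideal_module R I) 1) \<and> z \<in> rees_ker R I M (n - 1)})"

definition relation_type ::
    "('a, 'r) ring_scheme \<Rightarrow> 'a set \<Rightarrow> ('a, 'm, 'd) module_scheme \<Rightarrow> enat"
  where "relation_type R I M =
    (INF r\<in>{r::nat. 1 \<le> r \<and> (\<forall>n\<ge>r + 1.
        carrier (effective_relations R I M n) = {\<zero>\<^bsub>effective_relations R I M n\<^esub>})}. enat r)"

definition global_relation_type ::
    "('a, 'r) ring_scheme \<Rightarrow> ('a, 'm, 'd) module_scheme \<Rightarrow> enat"
  where "global_relation_type R M = (SUP I\<in>{I. ideal I R}. relation_type R I M)"


end

theory Submission
  imports Defs
begin

text \<open>
  Write \<open>T\<^sub>n(M) = S\<^sub>n(I) \<otimes> M\<close> and \<open>\<gamma>\<^sub>n : T\<^sub>n(M) \<rightarrow> I\<^sup>n M\<close>, and call the elements of \<open>ker \<gamma>\<^sub>n\<close> relations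
  of degree \<open>n\<close>. Both invariants are governed by conditions that compare consecutive degrees:
  \<open>s\<close> bounds the strong uniform number iff \<open>I\<^sup>n\<^sup>+\<^sup>1 M \<inter> N = I (I\<^sup>n M \<inter> N)\<close> for all \<open>n \<ge> s\<close>
  (\<open>power_trace_stable_iff\<close>), and \<open>r\<close> bounds the relation type iff for all \<open>n \<ge> r\<close> the relations of
  degree \<open>n + 1\<close> are generated by the products of \<open>S\<^sub>1(I)\<close> with the relations of degree \<open>n\<close>
  (\<open>effective_relations_trivial_iff\<close>). Both conditions persist when the bound grows, so the
  theorem follows once they are compared in a fixed degree.

  The comparison rests on the surjection \<open>\<pi>\<^sub>n : T\<^sub>n(M) \<rightarrow> T\<^sub>n(M/N)\<close>, which commutes with \<open>\<gamma>\<close> and with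
  multiplication by elements of \<open>S\<^sub>1(I)\<close>. It identifies relations of \<open>M/N\<close> with projections of
  elements whose value lies in \<open>I\<^sup>n M \<inter> N\<close> (\<open>rees_ker_proj_iff\<close>).

  For the first inequality (\<open>power_trace_Suc_if_no_relations\<close>) suppose that \<open>M/N\<close> has no new
  relations in degree \<open>n + 1\<close>, and let \<open>P = I (I\<^sup>n M \<inter> N)\<close>. As \<open>I\<^sup>n\<^sup>+\<^sup>1 N \<subseteq> P\<close>, the map
  \<open>\<gamma>\<^sub>n\<^sub>+\<^sub>1\<close> modulo \<open>P\<close> factors through \<open>T\<^sub>n\<^sub>+\<^sub>1(M/N)\<close>. The factored map kills all products of \<open>S\<^sub>1(I)\<close>
  with relations of degree \<open>n\<close>, hence all relations of degree \<open>n + 1\<close>, and this says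
  \<open>I\<^sup>n\<^sup>+\<^sup>1 M \<inter> N \<subseteq> P\<close>.

  For the second inequality (\<open>no_relations_quotient\<close>) a relation of \<open>M/N\<close> of degree \<open>n + 1\<close> is lifted
  to \<open>T\<^sub>n\<^sub>+\<^sub>1(M)\<close>. If \<open>I\<^sup>n\<^sup>+\<^sup>1 M \<inter> N = I (I\<^sup>n M \<inter> N)\<close>, the lift can be corrected by products that project
  to products with relations of \<open>M/N\<close>, so that it becomes a relation of \<open>M\<close>; if \<open>M\<close> has no new
  relations in degree \<open>n + 1\<close>, the corrected lift projects to the required form as well.

  The remaining parts set up the constructions that enter: quotients, free modules and
  tensor products by their universal properties, and the symmetric algebra \<open>S(I)\<close> with its grading
  and its evaluation map to the ring.
\<close>

section \<open>Linear maps and submodules\<close>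

definition mod_hom ::
    "('a, 'r) ring_scheme \<Rightarrow> ('a, 'm, 'd) module_scheme \<Rightarrow> ('a, 'q, 'e) module_scheme
      \<Rightarrow> ('m \<Rightarrow> 'q) set"
  where "mod_hom R M Q = {h. h \<in> carrier M \<rightarrow> carrier Q \<and>
    (\<forall>x\<in>carrier M. \<forall>y\<in>carrier M. h (x \<oplus>\<^bsub>M\<^esub> y) = h x \<oplus>\<^bsub>Q\<^esub> h y) \<and>
    (\<forall>a\<in>carrier R. \<forall>x\<in>carrier M. h (a \<odot>\<^bsub>M\<^esub> x) = a \<odot>\<^bsub>Q\<^esub> h x)}"

lemma mod_homI:
  assumes "\<And>x. x \<in> carrier M \<Longrightarrow> h x \<in> carrier Q"
    and "\<And>x y. x \<in> carrier M \<Longrightarrow> y \<in> carrier M \<Longrightarrow> h (x \<oplus>\<^bsub>M\<^esub> y) = h x \<oplus>\<^bsub>Q\<^esub> h y"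
    and "\<And>a x. a \<in> carrier R \<Longrightarrow> x \<in> carrier M \<Longrightarrow> h (a \<odot>\<^bsub>M\<^esub> x) = a \<odot>\<^bsub>Q\<^esub> h x"
  shows "h \<in> mod_hom R M Q"
  using assms unfolding mod_hom_def by auto

lemma mod_homD:
  assumes "h \<in> mod_hom R M Q"
  shows mod_hom_closed: "x \<in> carrier M \<Longrightarrow> h x \<in> carrier Q"
    and mod_hom_add: "x \<in> carrier M \<Longrightarrow> y \<in> carrier M \<Longrightarrow> h (x \<oplus>\<^bsub>M\<^esub> y) = h x \<oplus>\<^bsub>Q\<^esub> h y"
    and mod_hom_smult: "a \<in> carrier R \<Longrightarrow> x \<in> carrier M \<Longrightarrow> h (a \<odot>\<^bsub>M\<^esub> x) = a \<odot>\<^bsub>Q\<^esub> h x"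
  using assms unfolding mod_hom_def by auto

lemma mod_hom_comp:
  assumes "g \<in> mod_hom R M Q" "h \<in> mod_hom R Q K"
  shows "(\<lambda>x. h (g x)) \<in> mod_hom R M K"
  using assms unfolding mod_hom_def by (auto simp: Pi_iff)

lemma mod_hom_zero:
  assumes "Module.module R M" "Module.module R Q" "h \<in> mod_hom R M Q"
  shows "h \<zero>\<^bsub>M\<^esub> = \<zero>\<^bsub>Q\<^esub>"
proof -
  interpret M: Module.module R M by fact
  interpret Q: Module.module R Q by fact
  have "h (\<zero>\<^bsub>R\<^esub> \<odot>\<^bsub>M\<^esub> \<zero>\<^bsub>M\<^esub>) = \<zero>\<^bsub>R\<^esub> \<odot>\<^bsub>Q\<^esub> h \<zero>\<^bsub>M\<^esub>"
    using assms(3) by (intro mod_hom_smult) auto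
  then show ?thesis using mod_hom_closed[OF assms(3)] by simp
qed

lemma mod_hom_neg:
  assumes "Module.module R M" "Module.module R Q" "h \<in> mod_hom R M Q" "x \<in> carrier M"
  shows "h (\<ominus>\<^bsub>M\<^esub> x) = \<ominus>\<^bsub>Q\<^esub> h x"
proof -
  interpret M: Module.module R M by fact
  interpret Q: Module.module R Q by fact
  have eq: "\<ominus>\<^bsub>M\<^esub> x = (\<ominus>\<^bsub>R\<^esub> \<one>\<^bsub>R\<^esub>) \<odot>\<^bsub>M\<^esub> x"
    using assms(4) by (simp add: M.smult_l_minus)
  show ?thesis
    unfolding eq using assms(4) mod_hom_closed[OF assms(3,4)]
    by (simp add: mod_hom_smult[OF assms(3)] Q.smult_l_minus)
qed

lemma mod_hom_minus:
  assumes "Module.module R M" "Module.module R Q" "h \<in> mod_hom R M Q"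
    and "x \<in> carrier M" "y \<in> carrier M"
  shows "h (x \<ominus>\<^bsub>M\<^esub> y) = h x \<ominus>\<^bsub>Q\<^esub> h y"
proof -
  interpret M: Module.module R M by fact
  show ?thesis using assms
    by (simp add: a_minus_def mod_hom_add[OF assms(3)] mod_hom_neg[OF assms(1,2,3)])
qed

lemma submodule_subset:
  assumes "submodule H R M" shows "H \<subseteq> carrier M"
  using subgroup.subset[OF submodule.axioms(1)[OF assms]] by simp

lemma submodule_add:
  assumes "submodule H R M" "x \<in> H" "y \<in> H" shows "x \<oplus>\<^bsub>M\<^esub> y \<in> H"
  using subgroup.m_closed[OF submodule.axioms(1)[OF assms(1)]] assms by simp

lemma submodule_zero:
  assumes "submodule H R M" shows "\<zero>\<^bsub>M\<^esub> \<in> H"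
  using subgroup.one_closed[OF submodule.axioms(1)[OF assms(1)]] by simp

lemma submodule_neg:
  assumes "submodule H R M" "x \<in> H" shows "\<ominus>\<^bsub>M\<^esub> x \<in> H"
  using subgroup.m_inv_closed[OF submodule.axioms(1)[OF assms(1)]] assms(2)
  by (simp add: a_inv_def)

lemma submodule_vimage:
  assumes "Module.module R M" "Module.module R Q" "h \<in> mod_hom R M Q" "submodule H R Q"
  shows "submodule {x \<in> carrier M. h x \<in> H} R M"
proof -
  interpret M: Module.module R M by fact
  show ?thesis
    by (rule M.submoduleI)
       (use assms in \<open>auto simp: mod_hom_zero mod_hom_neg mod_hom_add mod_hom_smult
          submodule_zero submodule_neg submodule_add submodule.smult_closed\<close>)
qed

lemma submodule_zero_set:
  assumes "Module.module R M" shows "submodule {\<zero>\<^bsub>M\<^esub>} R M"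
proof -
  interpret M: Module.module R M by fact
  show ?thesis by (rule M.submoduleI) auto
qed

lemma submodule_image:
  assumes "Module.module R M" "Module.module R Q" "h \<in> mod_hom R M Q" "submodule K R M"
  shows "submodule (h ` K) R Q"
proof -
  interpret Q: Module.module R Q by fact
  have K: "x \<in> carrier M" if "x \<in> K" for x using submodule_subset[OF assms(4)] that by auto
  show ?thesis
  proof (rule Q.submoduleI)
    show "h ` K \<subseteq> carrier Q" using mod_hom_closed[OF assms(3)] K by auto
    show "\<zero>\<^bsub>Q\<^esub> \<in> h ` K"
      using mod_hom_zero[OF assms(1-3)] submodule_zero[OF assms(4)] by (auto intro: rev_image_eqI)
  next
    fix a assume "a \<in> h ` K"
    then show "\<ominus>\<^bsub>Q\<^esub> a \<in> h ` K"
      by (auto simp: mod_hom_neg[OF assms(1-3), symmetric] K submodule_neg[OF assms(4)])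
  next
    fix a b assume "a \<in> h ` K" "b \<in> h ` K"
    then show "a \<oplus>\<^bsub>Q\<^esub> b \<in> h ` K"
      by (auto simp: mod_hom_add[OF assms(3), symmetric] K submodule_add[OF assms(4)])
  next
    fix a x assume "a \<in> carrier R" "x \<in> h ` K"
    then show "a \<odot>\<^bsub>Q\<^esub> x \<in> h ` K"
      by (auto simp: mod_hom_smult[OF assms(3), symmetric] K submodule.smult_closed[OF assms(4)])
  qed
qed

lemma module_minus_eq_zero_iff:
  assumes "Module.module R M" "x \<in> carrier M" "y \<in> carrier M"
  shows "x \<ominus>\<^bsub>M\<^esub> y = \<zero>\<^bsub>M\<^esub> \<longleftrightarrow> x = y"
proof -
  interpret M: Module.module R M by fact
  show ?thesis
    using assms(2,3) M.minus_equality[of x "\<ominus>\<^bsub>M\<^esub> y"] M.r_neg[of y]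
    by (auto simp: a_minus_def)
qed

lemma submodule_equalizer:
  assumes "Module.module R M" "Module.module R Q" "g \<in> mod_hom R M Q" "h \<in> mod_hom R M Q"
  shows "submodule {x \<in> carrier M. g x = h x} R M"
proof -
  interpret M: Module.module R M by fact
  note g = mod_hom_zero[OF assms(1,2,3)] mod_hom_neg[OF assms(1,2,3)]
    mod_hom_add[OF assms(3)] mod_hom_smult[OF assms(3)]
  note h = mod_hom_zero[OF assms(1,2,4)] mod_hom_neg[OF assms(1,2,4)]
    mod_hom_add[OF assms(4)] mod_hom_smult[OF assms(4)]
  show ?thesis
    by (rule M.submoduleI) (auto simp: g h)
qed

lemma submodule_inter:
  assumes "Module.module R M" "submodule H R M" "submodule K R M"
  shows "submodule (H \<inter> K) R M"
proof -
  interpret M: Module.module R M by fact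
  show ?thesis
    by (rule M.submoduleI)
       (use assms submodule_subset[OF assms(2)] in \<open>auto simp:
          submodule_zero submodule_neg submodule_add submodule.smult_closed\<close>)
qed

section \<open>Generated submodules\<close>

lemma submodule_gen_minimal:
  assumes "submodule H R M" "S \<subseteq> H" shows "submodule_gen R M S \<subseteq> H"
  using assms unfolding submodule_gen_def by auto

lemma submodule_gen_incl: "S \<subseteq> submodule_gen R M S"
  unfolding submodule_gen_def by auto

lemma submodule_gen_submodule:
  assumes "Module.module R M" "S \<subseteq> carrier M"
  shows "submodule (submodule_gen R M S) R M"
proof -
  interpret M: Module.module R M by fact
  have "submodule_gen R M S \<subseteq> carrier M"
    by (rule submodule_gen_minimal[OF M.carrier_is_submodule assms(2)])
  then show ?thesis
    by (intro M.submoduleI)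
       (auto simp: submodule_gen_def
          intro: submodule_zero submodule_neg submodule_add submodule.smult_closed)
qed

section \<open>Quotient modules\<close>

lemma fact_module_simps:
  "carrier (fact_module M N) = a_rcosets\<^bsub>M\<^esub> N"
  "add (fact_module M N) = set_add M"
  "zero (fact_module M N) = N"
  "mult (fact_module M N) = rcoset_mult M N"
  "smult (fact_module M N) = (\<lambda>a X. \<Union>x\<in>X. N +>\<^bsub>M\<^esub> (a \<odot>\<^bsub>M\<^esub> x))"
  by (simp_all add: fact_module_def FactRing_def ring.defs module.defs)

lemma submodule_abelian_subgroup:
  assumes "Module.module R M" "submodule N R M"
  shows "abelian_subgroup N M"
proof -
  interpret M: Module.module R M by fact
  show ?thesis
    by (rule abelian_subgroupI3)
       (auto intro: additive_subgroupI submodule.axioms(1)[OF assms(2)] M.abelian_group_axioms)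
qed

lemma coset_eq_iff:
  assumes "Module.module R M" "submodule N R M" "x \<in> carrier M" "y \<in> carrier M"
  shows "N +>\<^bsub>M\<^esub> x = N +>\<^bsub>M\<^esub> y \<longleftrightarrow> x \<ominus>\<^bsub>M\<^esub> y \<in> N"
proof -
  interpret M: Module.module R M by fact
  interpret N: abelian_subgroup N M by (rule submodule_abelian_subgroup[OF assms(1,2)])
  have "N +>\<^bsub>M\<^esub> x = N +>\<^bsub>M\<^esub> y \<longleftrightarrow> x \<in> N +>\<^bsub>M\<^esub> y"
    using N.a_repr_independence'[OF _ assms(4)] N.a_rcos_self[OF assms(3)] by auto
  also have "\<dots> \<longleftrightarrow> x \<ominus>\<^bsub>M\<^esub> y \<in> N"
    unfolding a_minus_def by (rule N.a_rcos_module[OF assms(4,3)])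
  finally show ?thesis .
qed

lemma coset_eq_self_iff:
  assumes "Module.module R M" "submodule N R M" "x \<in> carrier M"
  shows "N +>\<^bsub>M\<^esub> x = N \<longleftrightarrow> x \<in> N"
proof -
  interpret M: Module.module R M by fact
  have "N +>\<^bsub>M\<^esub> \<zero>\<^bsub>M\<^esub> = N"
    by (rule M.a_coset_add_zero[OF submodule_subset[OF assms(2)]])
  then show ?thesis
    using coset_eq_iff[OF assms M.zero_closed] assms(3)
    by (simp add: a_minus_def M.minus_equality[of "\<zero>\<^bsub>M\<^esub>" "\<zero>\<^bsub>M\<^esub>"])
qed

lemma fact_module_carrierE:
  assumes "X \<in> carrier (fact_module M N)"
  obtains x where "x \<in> carrier M" "X = N +>\<^bsub>M\<^esub> x"
  using assms by (auto simp: fact_module_simps A_RCOSETS_def')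

lemma coset_closed: "x \<in> carrier M \<Longrightarrow> N +>\<^bsub>M\<^esub> x \<in> carrier (fact_module M N)"
  by (auto simp: fact_module_simps A_RCOSETS_def')

text \<open>The operations on cosets are written as unions or images over all representatives.
  A function that is constant modulo \<open>N\<close> has a one-point image on a coset, which is the form in
  which independence of the representative enters below.\<close>

lemma image_coset:
  assumes "Module.module R M" "submodule N R M" "x \<in> carrier M"
    and "\<And>y. y \<in> carrier M \<Longrightarrow> y \<ominus>\<^bsub>M\<^esub> x \<in> N \<Longrightarrow> f y = f x"
  shows "f ` (N +>\<^bsub>M\<^esub> x) = {f x}"
proof -
  interpret M: Module.module R M by fact
  interpret N: abelian_subgroup N M by (rule submodule_abelian_subgroup[OF assms(1,2)])
  have "f y = f x" if "y \<in> N +>\<^bsub>M\<^esub> x" for y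
  proof (rule assms(4))
    show "y \<in> carrier M" using N.a_elemrcos_carrier[OF assms(3) that] .
    then show "y \<ominus>\<^bsub>M\<^esub> x \<in> N"
      using N.a_rcos_module[OF assms(3)] that unfolding a_minus_def by auto
  qed
  then show ?thesis using N.a_rcos_self[OF assms(3)] by blast
qed

lemma coset_add:
  assumes "Module.module R M" "submodule N R M" "x \<in> carrier M" "y \<in> carrier M"
  shows "(N +>\<^bsub>M\<^esub> x) \<oplus>\<^bsub>fact_module M N\<^esub> (N +>\<^bsub>M\<^esub> y) = N +>\<^bsub>M\<^esub> (x \<oplus>\<^bsub>M\<^esub> y)"
proof -
  interpret N: abelian_subgroup N M by (rule submodule_abelian_subgroup[OF assms(1,2)])
  show ?thesis by (simp add: fact_module_simps N.a_rcos_sum assms)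
qed

lemma coset_smult:
  assumes "Module.module R M" "submodule N R M" "a \<in> carrier R" "x \<in> carrier M"
  shows "a \<odot>\<^bsub>fact_module M N\<^esub> (N +>\<^bsub>M\<^esub> x) = N +>\<^bsub>M\<^esub> (a \<odot>\<^bsub>M\<^esub> x)"
proof -
  interpret M: Module.module R M by fact
  have "(\<lambda>y. N +>\<^bsub>M\<^esub> (a \<odot>\<^bsub>M\<^esub> y)) ` (N +>\<^bsub>M\<^esub> x) = {N +>\<^bsub>M\<^esub> (a \<odot>\<^bsub>M\<^esub> x)}"
  proof (rule image_coset[OF assms(1,2,4)])
    fix y assume y: "y \<in> carrier M" "y \<ominus>\<^bsub>M\<^esub> x \<in> N"
    have "a \<odot>\<^bsub>M\<^esub> y \<ominus>\<^bsub>M\<^esub> a \<odot>\<^bsub>M\<^esub> x = a \<odot>\<^bsub>M\<^esub> (y \<ominus>\<^bsub>M\<^esub> x)"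
      using y(1) assms(3,4) by (simp add: a_minus_def M.smult_r_distr M.smult_r_minus)
    also have "\<dots> \<in> N" using submodule.smult_closed[OF assms(2,3) y(2)] .
    finally show "N +>\<^bsub>M\<^esub> (a \<odot>\<^bsub>M\<^esub> y) = N +>\<^bsub>M\<^esub> (a \<odot>\<^bsub>M\<^esub> x)"
      using coset_eq_iff[OF assms(1,2)] y(1) assms(3,4) by simp
  qed
  then show ?thesis unfolding fact_module_simps by simp
qed

lemma fact_module_module:
  assumes "Module.module R M" "submodule N R M"
  shows "Module.module R (fact_module M N)"
proof -
  interpret M: Module.module R M by fact
  interpret N: abelian_subgroup N M by (rule submodule_abelian_subgroup[OF assms])
  note simps = coset_add[OF assms] coset_smult[OF assms] coset_closed
  have z: "\<zero>\<^bsub>fact_module M N\<^esub> = N +>\<^bsub>M\<^esub> \<zero>\<^bsub>M\<^esub>"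
    using M.a_coset_add_zero[OF submodule_subset[OF assms(2)]] by (simp add: fact_module_simps)
  have "abelian_group (fact_module M N)"
  proof (rule abelian_groupI)
    fix X Y assume "X \<in> carrier (fact_module M N)" "Y \<in> carrier (fact_module M N)"
    then obtain x y where xy: "x \<in> carrier M" "y \<in> carrier M" "X = N +>\<^bsub>M\<^esub> x" "Y = N +>\<^bsub>M\<^esub> y"
      by (elim fact_module_carrierE) blast
    show "X \<oplus>\<^bsub>fact_module M N\<^esub> Y \<in> carrier (fact_module M N)"
      using xy by (simp add: simps)
    show "X \<oplus>\<^bsub>fact_module M N\<^esub> Y = Y \<oplus>\<^bsub>fact_module M N\<^esub> X"
      using xy by (simp add: simps M.a_comm)
    fix Z assume "Z \<in> carrier (fact_module M N)"
    then obtain z where "z \<in> carrier M" "Z = N +>\<^bsub>M\<^esub> z" by (elim fact_module_carrierE)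
    then show "X \<oplus>\<^bsub>fact_module M N\<^esub> Y \<oplus>\<^bsub>fact_module M N\<^esub> Z =
        X \<oplus>\<^bsub>fact_module M N\<^esub> (Y \<oplus>\<^bsub>fact_module M N\<^esub> Z)"
      using xy by (simp add: simps M.a_assoc)
  next
    show "\<zero>\<^bsub>fact_module M N\<^esub> \<in> carrier (fact_module M N)" by (simp add: z coset_closed)
  next
    fix X assume "X \<in> carrier (fact_module M N)"
    then obtain x where x: "x \<in> carrier M" "X = N +>\<^bsub>M\<^esub> x" by (elim fact_module_carrierE)
    show "\<zero>\<^bsub>fact_module M N\<^esub> \<oplus>\<^bsub>fact_module M N\<^esub> X = X" using x by (simp add: z simps)
    have "(N +>\<^bsub>M\<^esub> (\<ominus>\<^bsub>M\<^esub> x)) \<oplus>\<^bsub>fact_module M N\<^esub> X = \<zero>\<^bsub>fact_module M N\<^esub>"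
      using x by (simp add: z simps M.l_neg)
    then show "\<exists>Y\<in>carrier (fact_module M N). Y \<oplus>\<^bsub>fact_module M N\<^esub> X = \<zero>\<^bsub>fact_module M N\<^esub>"
      using x(1) by (meson M.a_inv_closed coset_closed)
  qed
  then show ?thesis
  proof (rule moduleI[OF M.is_cring])
    fix a b X assume ab: "a \<in> carrier R" "b \<in> carrier R" and "X \<in> carrier (fact_module M N)"
    then obtain x where x: "x \<in> carrier M" "X = N +>\<^bsub>M\<^esub> x" by (elim fact_module_carrierE)
    show "(a \<oplus>\<^bsub>R\<^esub> b) \<odot>\<^bsub>fact_module M N\<^esub> X =
        a \<odot>\<^bsub>fact_module M N\<^esub> X \<oplus>\<^bsub>fact_module M N\<^esub> b \<odot>\<^bsub>fact_module M N\<^esub> X"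
      using x ab by (simp add: simps M.smult_l_distr)
    show "(a \<otimes>\<^bsub>R\<^esub> b) \<odot>\<^bsub>fact_module M N\<^esub> X = a \<odot>\<^bsub>fact_module M N\<^esub> (b \<odot>\<^bsub>fact_module M N\<^esub> X)"
      using x ab by (simp add: simps M.smult_assoc1)
  next
    fix X assume "X \<in> carrier (fact_module M N)"
    then obtain x where x: "x \<in> carrier M" "X = N +>\<^bsub>M\<^esub> x" by (elim fact_module_carrierE)
    show "\<one>\<^bsub>R\<^esub> \<odot>\<^bsub>fact_module M N\<^esub> X = X" using x by (simp add: simps)
  next
    fix a X Y assume a: "a \<in> carrier R"
      and "X \<in> carrier (fact_module M N)" "Y \<in> carrier (fact_module M N)"
    then obtain x y where xy: "x \<in> carrier M" "y \<in> carrier M" "X = N +>\<^bsub>M\<^esub> x" "Y = N +>\<^bsub>M\<^esub> y"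
      by (elim fact_module_carrierE) blast
    show "a \<odot>\<^bsub>fact_module M N\<^esub> (X \<oplus>\<^bsub>fact_module M N\<^esub> Y) =
        a \<odot>\<^bsub>fact_module M N\<^esub> X \<oplus>\<^bsub>fact_module M N\<^esub> a \<odot>\<^bsub>fact_module M N\<^esub> Y"
      using xy a by (simp add: simps M.smult_r_distr)
  next
    fix a X assume a: "a \<in> carrier R" and "X \<in> carrier (fact_module M N)"
    then obtain x where x: "x \<in> carrier M" "X = N +>\<^bsub>M\<^esub> x" by (elim fact_module_carrierE)
    show "a \<odot>\<^bsub>fact_module M N\<^esub> X \<in> carrier (fact_module M N)"
      using x a by (simp add: simps)
  qed
qed

lemma coset_mod_hom:
  assumes "Module.module R M" "submodule N R M"
  shows "(\<lambda>x. N +>\<^bsub>M\<^esub> x) \<in> mod_hom R M (fact_module M N)"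
  by (rule mod_homI) (simp_all add: coset_add[OF assms] coset_smult[OF assms] coset_closed)

text \<open>A linear map that kills \<open>N\<close> takes a single value on each coset, and \<^const>\<open>the_elem\<close> reads it
  off. All maps out of tensor products and symmetric algebras arise in this way.\<close>

lemma mod_hom_fact:
  assumes "Module.module R M" "submodule N R M" "Module.module R Q"
    and "h \<in> mod_hom R M Q" "\<And>x. x \<in> N \<Longrightarrow> h x = \<zero>\<^bsub>Q\<^esub>"
  shows mod_hom_fact_coset: "x \<in> carrier M \<Longrightarrow> the_elem (h ` (N +>\<^bsub>M\<^esub> x)) = h x"
    and mod_hom_fact_hom: "(\<lambda>X. the_elem (h ` X)) \<in> mod_hom R (fact_module M N) Q"
proof -
  interpret M: Module.module R M by fact
  interpret Q: Module.module R Q by fact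
  have *: "the_elem (h ` (N +>\<^bsub>M\<^esub> x)) = h x" if x: "x \<in> carrier M" for x
  proof -
    have "h y = h x" if y: "y \<in> carrier M" "y \<ominus>\<^bsub>M\<^esub> x \<in> N" for y
    proof -
      have "h y \<ominus>\<^bsub>Q\<^esub> h x = \<zero>\<^bsub>Q\<^esub>"
        using mod_hom_minus[OF assms(1,3,4) y(1) x] assms(5)[OF y(2)] by simp
      then show ?thesis
        using module_minus_eq_zero_iff[OF assms(3)] mod_hom_closed[OF assms(4)] x y(1) by blast
    qed
    then have "h ` (N +>\<^bsub>M\<^esub> x) = {h x}" by (intro image_coset[OF assms(1,2) x])
    then show ?thesis by simp
  qed
  then show "x \<in> carrier M \<Longrightarrow> the_elem (h ` (N +>\<^bsub>M\<^esub> x)) = h x" .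
  show "(\<lambda>X. the_elem (h ` X)) \<in> mod_hom R (fact_module M N) Q"
  proof (rule mod_homI)
    fix X Y assume "X \<in> carrier (fact_module M N)" "Y \<in> carrier (fact_module M N)"
    then obtain x y where xy: "x \<in> carrier M" "y \<in> carrier M" "X = N +>\<^bsub>M\<^esub> x" "Y = N +>\<^bsub>M\<^esub> y"
      by (elim fact_module_carrierE) blast
    show "the_elem (h ` (X \<oplus>\<^bsub>fact_module M N\<^esub> Y)) = the_elem (h ` X) \<oplus>\<^bsub>Q\<^esub> the_elem (h ` Y)"
      using xy by (simp add: coset_add[OF assms(1,2)] * mod_hom_add[OF assms(4)])
  next
    fix X assume "X \<in> carrier (fact_module M N)"
    then obtain x where x: "x \<in> carrier M" "X = N +>\<^bsub>M\<^esub> x" by (elim fact_module_carrierE)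
    show "the_elem (h ` X) \<in> carrier Q" using x by (simp add: * mod_hom_closed[OF assms(4)])
    show "the_elem (h ` (a \<odot>\<^bsub>fact_module M N\<^esub> X)) = a \<odot>\<^bsub>Q\<^esub> the_elem (h ` X)"
      if "a \<in> carrier R" for a
      using x that by (simp add: coset_smult[OF assms(1,2)] * mod_hom_smult[OF assms(4)])
  qed
qed


lemma fact_module_trivial_iff:
  assumes "Module.module R M" "submodule N R M"
  shows "carrier (fact_module M N) = {\<zero>\<^bsub>fact_module M N\<^esub>} \<longleftrightarrow> carrier M \<subseteq> N"
proof -
  interpret M: Module.module R M by fact
  have "carrier (fact_module M N) = (\<lambda>x. N +>\<^bsub>M\<^esub> x) ` carrier M"
    by (auto simp: fact_module_simps A_RCOSETS_def')
  then have "carrier (fact_module M N) = {\<zero>\<^bsub>fact_module M N\<^esub>} \<longleftrightarrow>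
      (\<forall>x\<in>carrier M. N +>\<^bsub>M\<^esub> x = N)"
    using M.M.zero_closed by (simp add: fact_module_simps set_eq_iff image_iff) blast
  then show ?thesis using coset_eq_self_iff[OF assms] by auto
qed

text \<open>The module of effective relations is a quotient of a kernel regarded as a module in its
  own right, so the submodule divided out has to be seen inside that kernel.\<close>

lemma submodule_restrict:
  assumes "Module.module R M" "submodule K R M" "submodule G R M" "G \<subseteq> K"
  shows "submodule G R (M\<lparr>carrier := K\<rparr>)"
proof -
  interpret M: Module.module R M by fact
  have "subgroup G ((add_monoid M)\<lparr>carrier := K\<rparr>)"
    by (rule group.subgroup_incl[OF M.a_group submodule.axioms(1)[OF assms(3)]
          submodule.axioms(1)[OF assms(2)] assms(4)])
  then show ?thesis
    by (intro submodule.intro submodule_axioms.intro)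
       (auto intro: submodule.smult_closed[OF assms(3)])
qed

section \<open>Free modules\<close>

lemma free_module_simps:
  "carrier (free_module R X) =
    {f. (\<forall>x. f x \<in> carrier R) \<and> finite {x. f x \<noteq> \<zero>\<^bsub>R\<^esub>} \<and> {x. f x \<noteq> \<zero>\<^bsub>R\<^esub>} \<subseteq> X}"
  "zero (free_module R X) = (\<lambda>_. \<zero>\<^bsub>R\<^esub>)"
  "add (free_module R X) = (\<lambda>f g x. f x \<oplus>\<^bsub>R\<^esub> g x)"
  "smult (free_module R X) = (\<lambda>a f x. a \<otimes>\<^bsub>R\<^esub> f x)"
  by (simp_all add: free_module_def)

lemma free_carrierD:
  assumes "f \<in> carrier (free_module R X)"
  shows "f x \<in> carrier R" "finite {x. f x \<noteq> \<zero>\<^bsub>R\<^esub>}" "{x. f x \<noteq> \<zero>\<^bsub>R\<^esub>} \<subseteq> X"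
  using assms by (auto simp: free_module_simps)

lemma free_carrierI:
  assumes "\<And>x. f x \<in> carrier R" "finite S" "S \<subseteq> X" "\<And>x. x \<notin> S \<Longrightarrow> f x = \<zero>\<^bsub>R\<^esub>"
  shows "f \<in> carrier (free_module R X)"
proof -
  have "{x. f x \<noteq> \<zero>\<^bsub>R\<^esub>} \<subseteq> S" using assms(4) by auto
  then show ?thesis using assms(1-3) finite_subset by (auto simp: free_module_simps)
qed

lemma free_gen_closed:
  assumes "cring R" "x \<in> X"
  shows "free_gen R x \<in> carrier (free_module R X)"
proof -
  interpret cring R by fact
  show ?thesis
    by (rule free_carrierI[of _ _ "{x}"]) (use assms(2) in \<open>auto simp: free_gen_def\<close>)
qed

lemma free_module_module:
  assumes "cring R" shows "Module.module R (free_module R X)"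
proof -
  interpret R: cring R by fact
  let ?F = "free_module R X"
  have add: "f \<oplus>\<^bsub>?F\<^esub> g \<in> carrier ?F" if "f \<in> carrier ?F" "g \<in> carrier ?F" for f g
    by (rule free_carrierI[of _ _ "{x. f x \<noteq> \<zero>\<^bsub>R\<^esub>} \<union> {x. g x \<noteq> \<zero>\<^bsub>R\<^esub>}"])
       (use that in \<open>auto simp: free_module_simps\<close>)
  have smult: "a \<odot>\<^bsub>?F\<^esub> f \<in> carrier ?F" if "a \<in> carrier R" "f \<in> carrier ?F" for a f
    by (rule free_carrierI[of _ _ "{x. f x \<noteq> \<zero>\<^bsub>R\<^esub>}"])
       (use that in \<open>auto simp: free_module_simps\<close>)
  have zero: "\<zero>\<^bsub>?F\<^esub> \<in> carrier ?F"
    by (rule free_carrierI[of _ _ "{}"]) (auto simp: free_module_simps)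
  have "abelian_group ?F"
  proof (rule abelian_groupI)
    fix f assume f: "f \<in> carrier ?F"
    have "(\<lambda>x. \<ominus>\<^bsub>R\<^esub> f x) \<in> carrier ?F"
      by (rule free_carrierI[of _ _ "{x. f x \<noteq> \<zero>\<^bsub>R\<^esub>}"])
         (use f in \<open>auto simp: free_module_simps\<close>)
    moreover have "(\<lambda>x. \<ominus>\<^bsub>R\<^esub> f x) \<oplus>\<^bsub>?F\<^esub> f = \<zero>\<^bsub>?F\<^esub>"
      using free_carrierD(1)[OF f] by (simp add: free_module_simps R.l_neg)
    ultimately show "\<exists>g\<in>carrier ?F. g \<oplus>\<^bsub>?F\<^esub> f = \<zero>\<^bsub>?F\<^esub>" by blast
  next
    fix f g h assume "f \<in> carrier ?F" "g \<in> carrier ?F" "h \<in> carrier ?F"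
    then show "f \<oplus>\<^bsub>?F\<^esub> g \<oplus>\<^bsub>?F\<^esub> h = f \<oplus>\<^bsub>?F\<^esub> (g \<oplus>\<^bsub>?F\<^esub> h)"
      by (auto simp: free_module_simps R.a_assoc)
  next
    fix f g assume "f \<in> carrier ?F" "g \<in> carrier ?F"
    then show "f \<oplus>\<^bsub>?F\<^esub> g = g \<oplus>\<^bsub>?F\<^esub> f"
      using R.a_comm by (auto simp: free_module_simps)
  qed (use add zero in \<open>auto simp: free_module_simps\<close>)
  then show ?thesis
    by (rule moduleI[OF assms])
       (use smult in \<open>auto simp: free_module_simps R.l_distr R.r_distr R.m_assoc\<close>)
qed

text \<open>Induction on the support: deleting a point \<open>x\<close> from the support of \<open>f\<close> subtracts
  \<open>f x\<close> times a generator.\<close>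

lemma free_module_span:
  assumes "cring R" "submodule H R (free_module R X)" "\<And>x. x \<in> X \<Longrightarrow> free_gen R x \<in> H"
  shows "carrier (free_module R X) \<subseteq> H"
proof -
  interpret R: cring R by fact
  let ?F = "free_module R X"
  have "f \<in> H" if "finite S" "f \<in> carrier ?F" "{x. f x \<noteq> \<zero>\<^bsub>R\<^esub>} \<subseteq> S" for f S
    using that
  proof (induction S arbitrary: f rule: finite_induct)
    case empty
    then have "f = \<zero>\<^bsub>?F\<^esub>" by (auto simp: free_module_simps)
    then show ?case using submodule_zero[OF assms(2)] by simp
  next
    case (insert x S)
    show ?case
    proof (cases "f x = \<zero>\<^bsub>R\<^esub>")
      case True
      then show ?thesis using insert by auto
    next
      case False
      then have x: "x \<in> X" using insert.prems(1) free_carrierD(3) by blast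
      let ?g = "f(x := \<zero>\<^bsub>R\<^esub>)"
      have g: "?g \<in> carrier ?F"
        by (rule free_carrierI[of _ _ "{x. f x \<noteq> \<zero>\<^bsub>R\<^esub>}"])
           (use insert.prems(1) in \<open>auto simp: free_module_simps\<close>)
      have "?g \<in> H" by (rule insert.IH[OF g]) (use insert.prems(2) in auto)
      moreover have "f x \<odot>\<^bsub>?F\<^esub> free_gen R x \<in> H"
        by (rule submodule.smult_closed[OF assms(2)])
           (use assms(3)[OF x] free_carrierD(1)[OF insert.prems(1)] in auto)
      ultimately have "?g \<oplus>\<^bsub>?F\<^esub> f x \<odot>\<^bsub>?F\<^esub> free_gen R x \<in> H" by (rule submodule_add[OF assms(2)])
      moreover have "?g \<oplus>\<^bsub>?F\<^esub> f x \<odot>\<^bsub>?F\<^esub> free_gen R x = f"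
        using free_carrierD(1)[OF insert.prems(1)] by (auto simp: free_module_simps free_gen_def)
      ultimately show ?thesis by simp
    qed
  qed
  then show ?thesis using free_carrierD(2) by blast
qed

definition lin_ext ::
    "('a, 'r) ring_scheme \<Rightarrow> ('a, 'q, 'e) module_scheme \<Rightarrow> ('x \<Rightarrow> 'q) \<Rightarrow> ('x \<Rightarrow> 'a) \<Rightarrow> 'q"
  where "lin_ext R Q b f = (\<Oplus>\<^bsub>Q\<^esub>x\<in>{x. f x \<noteq> \<zero>\<^bsub>R\<^esub>}. f x \<odot>\<^bsub>Q\<^esub> b x)"

text \<open>The sum defining \<^const>\<open>lin_ext\<close> runs over the support, which changes under addition and
  scaling; linearity becomes visible once the sums run over a common finite set.\<close>

lemma lin_ext_superset:
  assumes "Module.module R Q" "\<And>x. x \<in> X \<Longrightarrow> b x \<in> carrier Q"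
    and "\<And>x. f x \<in> carrier R" "finite S" "S \<subseteq> X" "{x. f x \<noteq> \<zero>\<^bsub>R\<^esub>} \<subseteq> S"
  shows "lin_ext R Q b f = (\<Oplus>\<^bsub>Q\<^esub>x\<in>S. f x \<odot>\<^bsub>Q\<^esub> b x)"
proof -
  interpret Q: Module.module R Q by fact
  show ?thesis
    unfolding lin_ext_def
    by (rule Q.add.finprod_mono_neutral_cong_left) (use assms in auto)
qed

lemma lin_ext_hom:
  assumes "Module.module R Q" "\<And>x. x \<in> X \<Longrightarrow> b x \<in> carrier Q"
  shows "lin_ext R Q b \<in> mod_hom R (free_module R X) Q"
proof -
  interpret Q: Module.module R Q by fact
  let ?F = "free_module R X"
  interpret F: Module.module R ?F by (rule free_module_module[OF Q.is_cring])
  note sup = lin_ext_superset[OF assms(1), of X b, OF assms(2)]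
  show ?thesis
  proof (rule mod_homI)
    fix f assume f: "f \<in> carrier ?F"
    note fD = free_carrierD[OF f]
    show "lin_ext R Q b f \<in> carrier Q"
      unfolding lin_ext_def using fD assms(2) by (intro Q.finsum_closed) auto
    fix a assume a: "a \<in> carrier R"
    have "lin_ext R Q b (a \<odot>\<^bsub>?F\<^esub> f) = (\<Oplus>\<^bsub>Q\<^esub>x\<in>{x. f x \<noteq> \<zero>\<^bsub>R\<^esub>}. (a \<otimes>\<^bsub>R\<^esub> f x) \<odot>\<^bsub>Q\<^esub> b x)"
      by (subst sup[where S="{x. f x \<noteq> \<zero>\<^bsub>R\<^esub>}"]) (use fD a in \<open>auto simp: free_module_simps\<close>)
    also have "\<dots> = (\<Oplus>\<^bsub>Q\<^esub>x\<in>{x. f x \<noteq> \<zero>\<^bsub>R\<^esub>}. a \<odot>\<^bsub>Q\<^esub> (f x \<odot>\<^bsub>Q\<^esub> b x))"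
      using fD a assms(2) by (intro Q.finsum_cong') (auto simp: Q.smult_assoc1)
    also have "\<dots> = a \<odot>\<^bsub>Q\<^esub> lin_ext R Q b f"
      unfolding lin_ext_def using fD a assms(2)
      by (intro Q.finsum_smult_ldistr[symmetric]) auto
    finally show "lin_ext R Q b (a \<odot>\<^bsub>?F\<^esub> f) = a \<odot>\<^bsub>Q\<^esub> lin_ext R Q b f" .
  next
    fix f g assume f: "f \<in> carrier ?F" and g: "g \<in> carrier ?F"
    note fD = free_carrierD[OF f] and gD = free_carrierD[OF g]
    let ?S = "{x. f x \<noteq> \<zero>\<^bsub>R\<^esub>} \<union> {x. g x \<noteq> \<zero>\<^bsub>R\<^esub>}"
    have S: "finite ?S" "?S \<subseteq> X" using fD gD by auto
    have "lin_ext R Q b (f \<oplus>\<^bsub>?F\<^esub> g) = (\<Oplus>\<^bsub>Q\<^esub>x\<in>?S. (f x \<oplus>\<^bsub>R\<^esub> g x) \<odot>\<^bsub>Q\<^esub> b x)"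
      by (subst sup[where S="?S"]) (use fD gD in \<open>auto simp: free_module_simps\<close>)
    also have "\<dots> = (\<Oplus>\<^bsub>Q\<^esub>x\<in>?S. f x \<odot>\<^bsub>Q\<^esub> b x \<oplus>\<^bsub>Q\<^esub> g x \<odot>\<^bsub>Q\<^esub> b x)"
      using fD(1) gD(1) S assms(2)
      by (intro Q.finsum_cong') (auto simp: Q.smult_l_distr subset_eq)
    also have "\<dots> = (\<Oplus>\<^bsub>Q\<^esub>x\<in>?S. f x \<odot>\<^bsub>Q\<^esub> b x) \<oplus>\<^bsub>Q\<^esub> (\<Oplus>\<^bsub>Q\<^esub>x\<in>?S. g x \<odot>\<^bsub>Q\<^esub> b x)"
      using fD(1) gD(1) S assms(2) by (intro Q.finsum_addf) (auto simp: subset_eq)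
    also have "\<dots> = lin_ext R Q b f \<oplus>\<^bsub>Q\<^esub> lin_ext R Q b g"
      using sup[OF _ fD(1) S] sup[OF _ gD(1) S] by auto
    finally show "lin_ext R Q b (f \<oplus>\<^bsub>?F\<^esub> g) = lin_ext R Q b f \<oplus>\<^bsub>Q\<^esub> lin_ext R Q b g" .
  qed
qed

lemma lin_ext_gen:
  assumes "Module.module R Q" "b x \<in> carrier Q"
  shows "lin_ext R Q b (free_gen R x) = b x"
proof -
  interpret Q: Module.module R Q by fact
  have "lin_ext R Q b (free_gen R x) = (\<Oplus>\<^bsub>Q\<^esub>y\<in>{x}. free_gen R x y \<odot>\<^bsub>Q\<^esub> b y)"
    by (rule lin_ext_superset[OF assms(1), of "{x}"]) (use assms(2) in \<open>auto simp: free_gen_def\<close>)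
  also have "\<dots> = b x" using assms(2) by (simp add: free_gen_def)
  finally show ?thesis .
qed

section \<open>Tensor products\<close>

definition bilinear ::
    "('a, 'r) ring_scheme \<Rightarrow> ('a, 'p, 'c) module_scheme \<Rightarrow> ('a, 'm, 'd) module_scheme
      \<Rightarrow> ('a, 'q, 'e) module_scheme \<Rightarrow> ('p \<Rightarrow> 'm \<Rightarrow> 'q) \<Rightarrow> bool"
  where "bilinear R P M Q b \<longleftrightarrow>
    (\<forall>x\<in>carrier P. b x \<in> mod_hom R M Q) \<and> (\<forall>y\<in>carrier M. (\<lambda>x. b x y) \<in> mod_hom R P Q)"

lemma bilinearD:
  assumes "bilinear R P M Q b"
  shows "x \<in> carrier P \<Longrightarrow> y \<in> carrier M \<Longrightarrow> b x y \<in> carrier Q"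
    and "x \<in> carrier P \<Longrightarrow> x' \<in> carrier P \<Longrightarrow> y \<in> carrier M \<Longrightarrow>
      b (x \<oplus>\<^bsub>P\<^esub> x') y = b x y \<oplus>\<^bsub>Q\<^esub> b x' y"
    and "x \<in> carrier P \<Longrightarrow> y \<in> carrier M \<Longrightarrow> y' \<in> carrier M \<Longrightarrow>
      b x (y \<oplus>\<^bsub>M\<^esub> y') = b x y \<oplus>\<^bsub>Q\<^esub> b x y'"
    and "a \<in> carrier R \<Longrightarrow> x \<in> carrier P \<Longrightarrow> y \<in> carrier M \<Longrightarrow> b (a \<odot>\<^bsub>P\<^esub> x) y = a \<odot>\<^bsub>Q\<^esub> b x y"
    and "a \<in> carrier R \<Longrightarrow> x \<in> carrier P \<Longrightarrow> y \<in> carrier M \<Longrightarrow> b x (a \<odot>\<^bsub>M\<^esub> y) = a \<odot>\<^bsub>Q\<^esub> b x y"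
  using assms unfolding bilinear_def mod_hom_def by (auto simp: Pi_iff)

lemma bilinearI:
  assumes "\<And>x y. x \<in> carrier P \<Longrightarrow> y \<in> carrier M \<Longrightarrow> b x y \<in> carrier Q"
    and "\<And>x x' y. x \<in> carrier P \<Longrightarrow> x' \<in> carrier P \<Longrightarrow> y \<in> carrier M \<Longrightarrow>
      b (x \<oplus>\<^bsub>P\<^esub> x') y = b x y \<oplus>\<^bsub>Q\<^esub> b x' y"
    and "\<And>x y y'. x \<in> carrier P \<Longrightarrow> y \<in> carrier M \<Longrightarrow> y' \<in> carrier M \<Longrightarrow>
      b x (y \<oplus>\<^bsub>M\<^esub> y') = b x y \<oplus>\<^bsub>Q\<^esub> b x y'"
    and "\<And>a x y. a \<in> carrier R \<Longrightarrow> x \<in> carrier P \<Longrightarrow> y \<in> carrier M \<Longrightarrow>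
      b (a \<odot>\<^bsub>P\<^esub> x) y = a \<odot>\<^bsub>Q\<^esub> b x y"
    and "\<And>a x y. a \<in> carrier R \<Longrightarrow> x \<in> carrier P \<Longrightarrow> y \<in> carrier M \<Longrightarrow>
      b x (a \<odot>\<^bsub>M\<^esub> y) = a \<odot>\<^bsub>Q\<^esub> b x y"
  shows "bilinear R P M Q b"
  unfolding bilinear_def using assms by (auto intro!: mod_homI)

context
  fixes R :: "('a, 'r) ring_scheme" and P :: "('a, 'p, 'c) module_scheme"
    and M :: "('a, 'm, 'd) module_scheme"
  assumes P: "Module.module R P" and M: "Module.module R M"
begin

interpretation P: Module.module R P by (rule P)
interpretation M: Module.module R M by (rule M)

abbreviation (input) "pairs_module \<equiv> free_module R (carrier P \<times> carrier M)"

lemma pairs_module_module: "Module.module R pairs_module"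
  by (rule free_module_module[OF P.is_cring])

interpretation F: Module.module R pairs_module by (rule pairs_module_module)

lemma pair_gen_closed: "x \<in> carrier P \<Longrightarrow> y \<in> carrier M \<Longrightarrow> free_gen R (x, y) \<in> carrier pairs_module"
  by (intro free_gen_closed P.is_cring) auto

lemma tensor_rels_subset: "tensor_rels R P M \<subseteq> carrier pairs_module"
  unfolding tensor_rels_def Let_def a_minus_def by (auto intro!: pair_gen_closed)

lemma tensor_submodule_submodule: "submodule (tensor_submodule R P M) R pairs_module"
  unfolding tensor_submodule_def by (rule submodule_gen_submodule[OF pairs_module_module tensor_rels_subset])

lemma tensor_module: "Module.module R (tensor R P M)"
  unfolding tensor_def by (rule fact_module_module[OF pairs_module_module tensor_submodule_submodule])

lemma tensor_rels_in_submodule: "tensor_rels R P M \<subseteq> tensor_submodule R P M"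
  unfolding tensor_submodule_def by (rule submodule_gen_incl)

text \<open>The relations divided out of the free module on pairs are the differences of the two
  sides of each bilinearity law.\<close>

lemma pure_tensor_bilinear: "bilinear R P M (tensor R P M) (pure_tensor R P M)"
proof -
  note T = tensor_submodule_submodule
  have mem: "free_gen R (x, y) \<in> carrier pairs_module"
    "a \<in> carrier R \<Longrightarrow> a \<odot>\<^bsub>pairs_module\<^esub> free_gen R (x, y) \<in> carrier pairs_module"
    if "x \<in> carrier P" "y \<in> carrier M" for x y a
    using pair_gen_closed[OF that] by (blast intro: F.smult_closed)+
  note eq = coset_eq_iff[OF pairs_module_module T, THEN iffD2]
  note rel = tensor_rels_in_submodule[THEN subsetD]
  show ?thesis
    unfolding tensor_def pure_tensor_def
  proof (rule bilinearI, goal_cases)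
    case (1 x y)
    then show ?case by (intro coset_closed pair_gen_closed)
  next
    case (2 x x' y)
    have "free_gen R (x \<oplus>\<^bsub>P\<^esub> x', y) \<ominus>\<^bsub>pairs_module\<^esub>
        (free_gen R (x, y) \<oplus>\<^bsub>pairs_module\<^esub> free_gen R (x', y)) \<in> tensor_rels R P M"
      using 2 unfolding tensor_rels_def Let_def by blast
    then show ?case
      using 2 by (simp add: coset_add[OF pairs_module_module T] eq rel mem)
  next
    case (3 x y y')
    have "free_gen R (x, y \<oplus>\<^bsub>M\<^esub> y') \<ominus>\<^bsub>pairs_module\<^esub>
        (free_gen R (x, y) \<oplus>\<^bsub>pairs_module\<^esub> free_gen R (x, y')) \<in> tensor_rels R P M"
      using 3 unfolding tensor_rels_def Let_def by blast
    then show ?case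
      using 3 by (simp add: coset_add[OF pairs_module_module T] eq rel mem)
  next
    case (4 a x y)
    have "free_gen R (a \<odot>\<^bsub>P\<^esub> x, y) \<ominus>\<^bsub>pairs_module\<^esub> a \<odot>\<^bsub>pairs_module\<^esub> free_gen R (x, y)
        \<in> tensor_rels R P M"
      using 4 unfolding tensor_rels_def Let_def by blast
    then show ?case
      using 4 by (simp add: coset_smult[OF pairs_module_module T] eq rel mem)
  next
    case (5 a x y)
    have "free_gen R (x, a \<odot>\<^bsub>M\<^esub> y) \<ominus>\<^bsub>pairs_module\<^esub> a \<odot>\<^bsub>pairs_module\<^esub> free_gen R (x, y)
        \<in> tensor_rels R P M"
      using 5 unfolding tensor_rels_def Let_def by blast
    then show ?case
      using 5 by (simp add: coset_smult[OF pairs_module_module T] eq rel mem)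
  qed
qed

text \<open>Pulling \<open>H\<close> back to the free module on pairs reduces the claim to the spanning property of
  its generators, whose classes are the pure tensors.\<close>

lemma tensor_span:
  assumes "submodule H R (tensor R P M)"
    and "\<And>x y. x \<in> carrier P \<Longrightarrow> y \<in> carrier M \<Longrightarrow> pure_tensor R P M x y \<in> H"
  shows "carrier (tensor R P M) \<subseteq> H"
proof
  let ?c = "\<lambda>f. tensor_submodule R P M +>\<^bsub>pairs_module\<^esub> f"
  fix Z assume "Z \<in> carrier (tensor R P M)"
  then obtain f where f: "f \<in> carrier pairs_module" "Z = ?c f"
    unfolding tensor_def by (rule fact_module_carrierE)
  have c: "?c \<in> mod_hom R pairs_module (tensor R P M)"
    unfolding tensor_def by (rule coset_mod_hom[OF pairs_module_module tensor_submodule_submodule])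
  have "carrier pairs_module \<subseteq> {f \<in> carrier pairs_module. ?c f \<in> H}"
  proof (rule free_module_span[OF P.is_cring submodule_vimage[OF pairs_module_module tensor_module c assms(1)]])
    fix p assume "p \<in> carrier P \<times> carrier M"
    then obtain x y where p: "p = (x, y)" "x \<in> carrier P" "y \<in> carrier M" by auto
    then show "free_gen R p \<in> {f \<in> carrier pairs_module. ?c f \<in> H}"
      using assms(2)[OF p(2,3)] pair_gen_closed[OF p(2,3)] unfolding pure_tensor_def by simp
  qed
  then show "Z \<in> H" using f by auto
qed

lemma tensor_hom_eqI:
  assumes "Module.module R Q"
    and "g \<in> mod_hom R (tensor R P M) Q" "h \<in> mod_hom R (tensor R P M) Q"
    and "\<And>x y. x \<in> carrier P \<Longrightarrow> y \<in> carrier M \<Longrightarrow>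
      g (pure_tensor R P M x y) = h (pure_tensor R P M x y)"
    and "z \<in> carrier (tensor R P M)"
  shows "g z = h z"
proof -
  have "carrier (tensor R P M) \<subseteq> {z \<in> carrier (tensor R P M). g z = h z}"
    by (rule tensor_span[OF submodule_equalizer[OF tensor_module assms(1-3)]])
       (use assms(4) bilinearD(1)[OF pure_tensor_bilinear] in auto)
  then show ?thesis using assms(5) by auto
qed

text \<open>The universal property of the tensor product. The linear extension of a bilinear map
  sends every relation to a difference of equal elements, so it kills the submodule generated by
  the relations and descends to the quotient.\<close>

lemma tensor_lift:
  assumes Q: "Module.module R Q" and b: "bilinear R P M Q b"
  shows tensor_lift_hom: "tensor_lift R Q b \<in> mod_hom R (tensor R P M) Q"
    and tensor_lift_pure: "x \<in> carrier P \<Longrightarrow> y \<in> carrier M \<Longrightarrow>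
      tensor_lift R Q b (pure_tensor R P M x y) = b x y"
proof -
  interpret Q: Module.module R Q by (rule Q)
  let ?b = "\<lambda>p. b (fst p) (snd p)"
  let ?h = "lin_ext R Q ?b"
  have lift: "tensor_lift R Q b = (\<lambda>Z. the_elem (?h ` Z))"
    unfolding tensor_lift_def lin_ext_def by (rule refl)
  have h: "?h \<in> mod_hom R pairs_module Q"
    by (rule lin_ext_hom[OF Q]) (auto intro: bilinearD(1)[OF b])
  have gen: "?h (free_gen R (x, y)) = b x y" if "x \<in> carrier P" "y \<in> carrier M" for x y
    using lin_ext_gen[OF Q, of ?b "(x, y)"] bilinearD(1)[OF b that] by simp
  have kill: "?h z = \<zero>\<^bsub>Q\<^esub>" if "z \<in> tensor_submodule R P M" for z
  proof -
    note hm = mod_hom_minus[OF pairs_module_module Q h] mod_hom_add[OF h] mod_hom_smult[OF h]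
      pair_gen_closed gen bilinearD[OF b] module_minus_eq_zero_iff[OF Q]
    have "tensor_rels R P M \<subseteq> {z \<in> carrier pairs_module. ?h z \<in> {\<zero>\<^bsub>Q\<^esub>}}"
      using tensor_rels_subset
      by (auto simp: tensor_rels_def Let_def hm)
    then have "tensor_submodule R P M \<subseteq> {z \<in> carrier pairs_module. ?h z \<in> {\<zero>\<^bsub>Q\<^esub>}}"
      unfolding tensor_submodule_def
      by (intro submodule_gen_minimal submodule_vimage[OF pairs_module_module Q h] submodule_zero_set[OF Q])
    then show ?thesis using that by auto
  qed
  show "tensor_lift R Q b \<in> mod_hom R (tensor R P M) Q"
    unfolding lift tensor_def
    by (rule mod_hom_fact_hom[OF pairs_module_module tensor_submodule_submodule Q h kill])
  show "tensor_lift R Q b (pure_tensor R P M x y) = b x y" if "x \<in> carrier P" "y \<in> carrier M"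
    unfolding lift pure_tensor_def gen[OF that, symmetric]
    by (rule mod_hom_fact_coset[OF pairs_module_module tensor_submodule_submodule Q h kill
          pair_gen_closed[OF that]])
qed

end

section \<open>Polynomial algebras\<close>

lemma free_hom_eqI:
  assumes "Module.module R Q"
    and "g \<in> mod_hom R (free_module R X) Q" "h \<in> mod_hom R (free_module R X) Q"
    and "\<And>x. x \<in> X \<Longrightarrow> g (free_gen R x) = h (free_gen R x)"
    and "f \<in> carrier (free_module R X)"
  shows "g f = h f"
proof -
  interpret Q: Module.module R Q by fact
  have "carrier (free_module R X) \<subseteq> {f \<in> carrier (free_module R X). g f = h f}"
    by (rule free_module_span[OF Q.is_cring
          submodule_equalizer[OF free_module_module[OF Q.is_cring] assms(1-3)]])
       (use assms(4) free_gen_closed[OF Q.is_cring] in auto)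
  then show ?thesis using assms(5) by auto
qed

lemma finite_submultisets: "finite {k. k \<subseteq># m}"
proof (induction m)
  case (add x m)
  have "{k. k \<subseteq># add_mset x m} \<subseteq> {k. k \<subseteq># m} \<union> add_mset x ` {k. k \<subseteq># m}"
  proof
    fix k assume "k \<in> {k. k \<subseteq># add_mset x m}"
    then have k: "k \<subseteq># add_mset x m" by simp
    show "k \<in> {k. k \<subseteq># m} \<union> add_mset x ` {k. k \<subseteq># m}"
    proof (cases "x \<in># k")
      case True
      then obtain l where l: "k = add_mset x l" by (meson multi_member_split)
      then show ?thesis using k by auto
    next
      case False
      then have "k \<subseteq># m"
        using k by (simp add: subset_mset.le_iff_sup subseteq_mset_def not_in_iff)
      then show ?thesis by simp
    qed
  qed
  then show ?case using add.IH by (meson finite_UnI finite_imageI finite_subset)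
qed simp

abbreviation (input) monomials :: "'x set \<Rightarrow> 'x multiset set"
  where "monomials X \<equiv> {m. set_mset m \<subseteq> X}"

text \<open>Apart from multiplication and unit the polynomial algebra is the free module on the
  monomials, so all additive facts are inherited from there.\<close>

lemma poly_simps:
  "carrier (poly_algebra R X) = carrier (free_module R (monomials X))"
  "zero (poly_algebra R X) = zero (free_module R (monomials X))"
  "add (poly_algebra R X) = add (free_module R (monomials X))"
  "smult (poly_algebra R X) = smult (free_module R (monomials X))"
  "mult (poly_algebra R X) = (\<lambda>p q m. \<Oplus>\<^bsub>R\<^esub>k\<in>{k. k \<subseteq># m}. p k \<otimes>\<^bsub>R\<^esub> q (m - k))"
  "one (poly_algebra R X) = free_gen R {#}"
  "add_monoid (poly_algebra R X) = add_monoid (free_module R (monomials X))"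
  "a_inv (poly_algebra R X) = a_inv (free_module R (monomials X))"
  by (simp_all add: poly_algebra_def a_inv_def)

context
  fixes R :: "('a, 'r) ring_scheme" and X :: "'x set"
  assumes R: "cring R"
begin

interpretation R: cring R by (rule R)

abbreviation (input) "polyR \<equiv> poly_algebra R X"

lemma poly_module: "Module.module R polyR"
proof -
  interpret F: Module.module R "free_module R (monomials X)" by (rule free_module_module[OF R])
  have "abelian_group polyR"
    unfolding abelian_group_def abelian_monoid_def abelian_group_axioms_def
    using F.abelian_group_axioms
    by (simp add: poly_simps abelian_group_def abelian_monoid_def abelian_group_axioms_def)
  then show ?thesis
    by (rule moduleI[OF R])
       (simp_all add: poly_simps F.smult_l_distr F.smult_r_distr F.smult_assoc1)
qed

interpretation P: Module.module R polyR by (rule poly_module)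

lemma mod_hom_poly: "mod_hom R polyR Q = mod_hom R (free_module R (monomials X)) Q"
  by (simp add: mod_hom_def poly_simps)

lemma monomial_closed: "set_mset m \<subseteq> X \<Longrightarrow> free_gen R m \<in> carrier polyR"
  unfolding poly_simps by (intro free_gen_closed R) simp

lemma poly_hom_eqI:
  assumes "Module.module R Q" "g \<in> mod_hom R polyR Q" "h \<in> mod_hom R polyR Q"
    and "\<And>m. set_mset m \<subseteq> X \<Longrightarrow> g (free_gen R m) = h (free_gen R m)"
    and "f \<in> carrier polyR"
  shows "g f = h f"
  by (rule free_hom_eqI[OF assms(1), of _ "monomials X"])
     (use assms in \<open>auto simp: mod_hom_poly poly_simps\<close>)

text \<open>A coefficient of a product is nonzero only if some summand of the convolution is. This
  bounds the support of the product, and it also shows that degrees add.\<close>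

lemma poly_mult_nonzeroE:
  assumes "p \<in> carrier polyR" "q \<in> carrier polyR" "(p \<otimes>\<^bsub>polyR\<^esub> q) m \<noteq> \<zero>\<^bsub>R\<^esub>"
  obtains k l where "m = k + l" "p k \<noteq> \<zero>\<^bsub>R\<^esub>" "q l \<noteq> \<zero>\<^bsub>R\<^esub>"
proof (rule ccontr)
  assume contr: "\<not> thesis"
  note elim = that
  note pq = assms(1,2)[unfolded poly_simps, THEN free_carrierD(1)]
  have "p k \<otimes>\<^bsub>R\<^esub> q (m - k) = \<zero>\<^bsub>R\<^esub>" if "k \<subseteq># m" for k
  proof -
    have "m = k + (m - k)" using that by simp
    then have "p k = \<zero>\<^bsub>R\<^esub> \<or> q (m - k) = \<zero>\<^bsub>R\<^esub>" using contr elim[of k "m - k"] by blast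
    then show ?thesis using pq by auto
  qed
  then have "(\<Oplus>\<^bsub>R\<^esub>k\<in>{k. k \<subseteq># m}. p k \<otimes>\<^bsub>R\<^esub> q (m - k)) = \<zero>\<^bsub>R\<^esub>"
    by (intro R.add.finprod_one_eqI) auto
  then show False using assms(3) by (simp add: poly_simps)
qed

lemma poly_mult_bilinear: "bilinear R polyR polyR polyR (mult polyR)"
proof (rule bilinearI)
  fix p q assume p: "p \<in> carrier polyR" and q: "q \<in> carrier polyR"
  note pD = p[unfolded poly_simps, THEN free_carrierD(1)]
    p[unfolded poly_simps, THEN free_carrierD(2)] p[unfolded poly_simps, THEN free_carrierD(3)]
  note qD = q[unfolded poly_simps, THEN free_carrierD(1)]
    q[unfolded poly_simps, THEN free_carrierD(2)] q[unfolded poly_simps, THEN free_carrierD(3)]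
  let ?S = "(\<lambda>(k, l). k + l) ` ({k. p k \<noteq> \<zero>\<^bsub>R\<^esub>} \<times> {l. q l \<noteq> \<zero>\<^bsub>R\<^esub>})"
  show "p \<otimes>\<^bsub>polyR\<^esub> q \<in> carrier polyR"
    unfolding poly_simps(1)
  proof (rule free_carrierI[of _ _ ?S])
    show "(p \<otimes>\<^bsub>polyR\<^esub> q) m \<in> carrier R" for m
      unfolding poly_simps using pD(1) qD(1) by (intro R.finsum_closed) auto
    show "finite ?S" using pD qD by blast
    show "?S \<subseteq> monomials X"
    proof
      fix m assume "m \<in> ?S"
      then obtain k l where "m = k + l" "k \<in> {k. p k \<noteq> \<zero>\<^bsub>R\<^esub>}" "l \<in> {l. q l \<noteq> \<zero>\<^bsub>R\<^esub>}" by auto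
      then show "m \<in> monomials X" using subsetD[OF pD(3)] subsetD[OF qD(3)] by simp
    qed
    show "(p \<otimes>\<^bsub>polyR\<^esub> q) m = \<zero>\<^bsub>R\<^esub>" if "m \<notin> ?S" for m
    proof (rule ccontr)
      assume "(p \<otimes>\<^bsub>polyR\<^esub> q) m \<noteq> \<zero>\<^bsub>R\<^esub>"
      then obtain k l where "m = k + l" "p k \<noteq> \<zero>\<^bsub>R\<^esub>" "q l \<noteq> \<zero>\<^bsub>R\<^esub>"
        by (rule poly_mult_nonzeroE[OF p q])
      then have "m \<in> ?S" by (intro image_eqI[of _ _ "(k, l)"]) auto
      then show False using that by contradiction
    qed
  qed
  fix a assume a: "a \<in> carrier R"
  have *: "(\<Oplus>\<^bsub>R\<^esub>k\<in>{k. k \<subseteq># m}. a \<otimes>\<^bsub>R\<^esub> (p k \<otimes>\<^bsub>R\<^esub> q (m - k)))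
      = a \<otimes>\<^bsub>R\<^esub> (\<Oplus>\<^bsub>R\<^esub>k\<in>{k. k \<subseteq># m}. p k \<otimes>\<^bsub>R\<^esub> q (m - k))" for m
    by (rule R.finsum_rdistr[symmetric]) (use pD(1) qD(1) a finite_submultisets in auto)
  have "(\<Oplus>\<^bsub>R\<^esub>k\<in>{k. k \<subseteq># m}. (a \<otimes>\<^bsub>R\<^esub> p k) \<otimes>\<^bsub>R\<^esub> q (m - k))
      = (\<Oplus>\<^bsub>R\<^esub>k\<in>{k. k \<subseteq># m}. a \<otimes>\<^bsub>R\<^esub> (p k \<otimes>\<^bsub>R\<^esub> q (m - k)))" for m
    by (rule R.finsum_cong') (use pD(1) qD(1) a in \<open>auto simp: R.m_assoc\<close>)
  then show "(a \<odot>\<^bsub>polyR\<^esub> p) \<otimes>\<^bsub>polyR\<^esub> q = a \<odot>\<^bsub>polyR\<^esub> (p \<otimes>\<^bsub>polyR\<^esub> q)"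
    using * by (simp add: poly_simps free_module_simps)
  have "(\<Oplus>\<^bsub>R\<^esub>k\<in>{k. k \<subseteq># m}. p k \<otimes>\<^bsub>R\<^esub> (a \<otimes>\<^bsub>R\<^esub> q (m - k)))
      = (\<Oplus>\<^bsub>R\<^esub>k\<in>{k. k \<subseteq># m}. a \<otimes>\<^bsub>R\<^esub> (p k \<otimes>\<^bsub>R\<^esub> q (m - k)))" for m
    by (rule R.finsum_cong') (use pD(1) qD(1) a in \<open>auto simp: R.m_lcomm\<close>)
  then show "p \<otimes>\<^bsub>polyR\<^esub> (a \<odot>\<^bsub>polyR\<^esub> q) = a \<odot>\<^bsub>polyR\<^esub> (p \<otimes>\<^bsub>polyR\<^esub> q)"
    using * by (simp add: poly_simps free_module_simps)
next
  fix p p' q assume pq: "p \<in> carrier polyR" "p' \<in> carrier polyR" "q \<in> carrier polyR"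
  note c = pq[unfolded poly_simps, THEN free_carrierD(1)]
  have "(\<Oplus>\<^bsub>R\<^esub>k\<in>{k. k \<subseteq># m}. (p k \<oplus>\<^bsub>R\<^esub> p' k) \<otimes>\<^bsub>R\<^esub> q (m - k))
      = (\<Oplus>\<^bsub>R\<^esub>k\<in>{k. k \<subseteq># m}. p k \<otimes>\<^bsub>R\<^esub> q (m - k) \<oplus>\<^bsub>R\<^esub> p' k \<otimes>\<^bsub>R\<^esub> q (m - k))" for m
    by (rule R.finsum_cong') (use c in \<open>auto simp: R.l_distr\<close>)
  also have "\<dots> m = (\<Oplus>\<^bsub>R\<^esub>k\<in>{k. k \<subseteq># m}. p k \<otimes>\<^bsub>R\<^esub> q (m - k))
      \<oplus>\<^bsub>R\<^esub> (\<Oplus>\<^bsub>R\<^esub>k\<in>{k. k \<subseteq># m}. p' k \<otimes>\<^bsub>R\<^esub> q (m - k))" for m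
    by (rule R.finsum_addf) (use c in auto)
  finally show "(p \<oplus>\<^bsub>polyR\<^esub> p') \<otimes>\<^bsub>polyR\<^esub> q = p \<otimes>\<^bsub>polyR\<^esub> q \<oplus>\<^bsub>polyR\<^esub> p' \<otimes>\<^bsub>polyR\<^esub> q"
    by (simp add: poly_simps free_module_simps)
next
  fix p q q' assume pq: "p \<in> carrier polyR" "q \<in> carrier polyR" "q' \<in> carrier polyR"
  note c = pq[unfolded poly_simps, THEN free_carrierD(1)]
  have "(\<Oplus>\<^bsub>R\<^esub>k\<in>{k. k \<subseteq># m}. p k \<otimes>\<^bsub>R\<^esub> (q (m - k) \<oplus>\<^bsub>R\<^esub> q' (m - k)))
      = (\<Oplus>\<^bsub>R\<^esub>k\<in>{k. k \<subseteq># m}. p k \<otimes>\<^bsub>R\<^esub> q (m - k) \<oplus>\<^bsub>R\<^esub> p k \<otimes>\<^bsub>R\<^esub> q' (m - k))" for m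
    by (rule R.finsum_cong') (use c in \<open>auto simp: R.r_distr\<close>)
  also have "\<dots> m = (\<Oplus>\<^bsub>R\<^esub>k\<in>{k. k \<subseteq># m}. p k \<otimes>\<^bsub>R\<^esub> q (m - k))
      \<oplus>\<^bsub>R\<^esub> (\<Oplus>\<^bsub>R\<^esub>k\<in>{k. k \<subseteq># m}. p k \<otimes>\<^bsub>R\<^esub> q' (m - k))" for m
    by (rule R.finsum_addf) (use c in auto)
  finally show "p \<otimes>\<^bsub>polyR\<^esub> (q \<oplus>\<^bsub>polyR\<^esub> q') = p \<otimes>\<^bsub>polyR\<^esub> q \<oplus>\<^bsub>polyR\<^esub> p \<otimes>\<^bsub>polyR\<^esub> q'"
    by (simp add: poly_simps free_module_simps)
qed

lemma monomial_mult: "free_gen R k \<otimes>\<^bsub>polyR\<^esub> free_gen R l = free_gen R (k + l)"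
proof
  fix m
  show "(free_gen R k \<otimes>\<^bsub>polyR\<^esub> free_gen R l) m = free_gen R (k + l) m"
  proof (cases "k \<subseteq># m")
    case True
    have "(\<Oplus>\<^bsub>R\<^esub>j\<in>{j. j \<subseteq># m}. free_gen R k j \<otimes>\<^bsub>R\<^esub> free_gen R l (m - j))
        = (\<Oplus>\<^bsub>R\<^esub>j\<in>{k}. free_gen R k j \<otimes>\<^bsub>R\<^esub> free_gen R l (m - j))"
      by (rule R.add.finprod_mono_neutral_cong_left[symmetric])
         (use True finite_submultisets in \<open>auto simp: free_gen_def\<close>)
    also have "\<dots> = free_gen R l (m - k)" by (simp add: free_gen_def)
    finally have "(free_gen R k \<otimes>\<^bsub>polyR\<^esub> free_gen R l) m = free_gen R l (m - k)"
      by (simp add: poly_simps)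
    moreover have "m = k + l \<longleftrightarrow> m - k = l"
      using True by (metis add_diff_cancel_left' subset_mset.add_diff_inverse)
    ultimately show ?thesis by (simp add: free_gen_def)
  next
    case False
    have "(\<Oplus>\<^bsub>R\<^esub>j\<in>{j. j \<subseteq># m}. free_gen R k j \<otimes>\<^bsub>R\<^esub> free_gen R l (m - j)) = \<zero>\<^bsub>R\<^esub>"
      by (rule R.add.finprod_one_eqI) (use False in \<open>auto simp: free_gen_def\<close>)
    moreover have "m \<noteq> k + l" using False by auto
    ultimately show ?thesis by (simp add: poly_simps free_gen_def)
  qed
qed

lemma mult_hom_l: "q \<in> carrier polyR \<Longrightarrow> (\<lambda>p. p \<otimes>\<^bsub>polyR\<^esub> q) \<in> mod_hom R polyR polyR"
  and mult_hom_r: "q \<in> carrier polyR \<Longrightarrow> (\<lambda>p. q \<otimes>\<^bsub>polyR\<^esub> p) \<in> mod_hom R polyR polyR"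
  using poly_mult_bilinear by (auto simp: bilinear_def)

text \<open>Both sides of each ring law are linear in every factor. A linear map on polynomials is
  determined by its values on monomials, so the laws reduce to those of multiset addition and no
  double sum over submultisets has to be rearranged.\<close>

lemma poly_cring: "cring polyR"
proof -
  note closed = bilinearD(1)[OF poly_mult_bilinear] and gen = monomial_closed
  have comm: "p \<otimes>\<^bsub>polyR\<^esub> q = q \<otimes>\<^bsub>polyR\<^esub> p" if "p \<in> carrier polyR" "q \<in> carrier polyR" for p q
  proof (rule poly_hom_eqI[OF poly_module mult_hom_l[OF that(2)] mult_hom_r[OF that(2)] _ that(1)])
    fix k assume "set_mset k \<subseteq> X"
    then have k: "free_gen R k \<in> carrier polyR" by (rule gen)
    show "free_gen R k \<otimes>\<^bsub>polyR\<^esub> q = q \<otimes>\<^bsub>polyR\<^esub> free_gen R k"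
      by (rule poly_hom_eqI[OF poly_module mult_hom_r[OF k] mult_hom_l[OF k] _ that(2)])
         (simp add: monomial_mult add.commute)
  qed
  have assoc: "(p \<otimes>\<^bsub>polyR\<^esub> q) \<otimes>\<^bsub>polyR\<^esub> r = p \<otimes>\<^bsub>polyR\<^esub> (q \<otimes>\<^bsub>polyR\<^esub> r)"
    if p: "p \<in> carrier polyR" and q: "q \<in> carrier polyR" and r: "r \<in> carrier polyR" for p q r
  proof (rule poly_hom_eqI[OF poly_module mod_hom_comp[OF mult_hom_l[OF q] mult_hom_l[OF r]]
        mult_hom_l[OF closed[OF q r]] _ p])
    fix k assume "set_mset k \<subseteq> X"
    then have k: "free_gen R k \<in> carrier polyR" by (rule gen)
    show "(free_gen R k \<otimes>\<^bsub>polyR\<^esub> q) \<otimes>\<^bsub>polyR\<^esub> r = free_gen R k \<otimes>\<^bsub>polyR\<^esub> (q \<otimes>\<^bsub>polyR\<^esub> r)"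
    proof (rule poly_hom_eqI[OF poly_module mod_hom_comp[OF mult_hom_r[OF k] mult_hom_l[OF r]]
          mod_hom_comp[OF mult_hom_l[OF r] mult_hom_r[OF k]] _ q])
      fix l assume "set_mset l \<subseteq> X"
      then have l: "free_gen R l \<in> carrier polyR" by (rule gen)
      show "(free_gen R k \<otimes>\<^bsub>polyR\<^esub> free_gen R l) \<otimes>\<^bsub>polyR\<^esub> r
          = free_gen R k \<otimes>\<^bsub>polyR\<^esub> (free_gen R l \<otimes>\<^bsub>polyR\<^esub> r)"
        by (rule poly_hom_eqI[OF poly_module mult_hom_r[OF closed[OF k l]]
              mod_hom_comp[OF mult_hom_r[OF l] mult_hom_r[OF k]] _ r])
           (simp add: monomial_mult add.assoc)
    qed
  qed
  have one: "free_gen R {#} \<in> carrier polyR" by (rule gen) simp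
  have id: "(\<lambda>p. p) \<in> mod_hom R polyR polyR" by (rule mod_homI) auto
  show ?thesis
  proof (intro cringI P.abelian_group_axioms comm_monoidI)
    fix p assume p: "p \<in> carrier polyR"
    show "\<one>\<^bsub>polyR\<^esub> \<otimes>\<^bsub>polyR\<^esub> p = p"
      unfolding poly_simps(6)
      by (rule poly_hom_eqI[OF poly_module mult_hom_r[OF one] id _ p]) (simp add: monomial_mult)
  qed (use closed one comm assoc bilinearD(2)[OF poly_mult_bilinear] in \<open>auto simp: poly_simps(6)\<close>)
qed

lemma poly_ideal_submodule:
  assumes "ideal J polyR" shows "submodule J R polyR"
proof -
  interpret PR: cring polyR by (rule poly_cring)
  interpret J: ideal J polyR by fact
  show ?thesis
  proof (rule P.submoduleI)
    fix a p assume a: "a \<in> carrier R" and p: "p \<in> J"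
    then have pc: "p \<in> carrier polyR" using J.a_Hcarr by blast
    have "a \<odot>\<^bsub>polyR\<^esub> p = (a \<odot>\<^bsub>polyR\<^esub> \<one>\<^bsub>polyR\<^esub>) \<otimes>\<^bsub>polyR\<^esub> p"
      using bilinearD(4)[OF poly_mult_bilinear a _ pc] pc by simp
    then show "a \<odot>\<^bsub>polyR\<^esub> p \<in> J" using J.I_l_closed[OF p] a by simp
  qed (use J.a_Hcarr in auto)
qed

end

section \<open>Evaluation of monomials and powers of ideals\<close>

lemma ideal_module_simps:
  "carrier (ideal_module R I) = I" "add (ideal_module R I) = add R"
  "zero (ideal_module R I) = zero R" "smult (ideal_module R I) = mult R"
  by (simp_all add: ideal_module_def)

text \<open>The ring as a module over itself is the target of the evaluation map.\<close>

abbreviation (input) regular_module :: "('a, 'r) ring_scheme \<Rightarrow> ('a, 'a) module"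
  where "regular_module R \<equiv> ideal_module R (carrier R)"

lemma regular_module_module:
  assumes "cring R" shows "Module.module R (regular_module R)"
proof -
  interpret cring R by fact
  have "abelian_group (regular_module R)"
  proof (rule abelian_groupI)
    fix x assume "x \<in> carrier (regular_module R)"
    then show "\<exists>y\<in>carrier (regular_module R). y \<oplus>\<^bsub>regular_module R\<^esub> x = \<zero>\<^bsub>regular_module R\<^esub>"
      by (intro bexI[of _ "\<ominus>\<^bsub>R\<^esub> x"]) (auto simp: ideal_module_simps l_neg)
  qed (auto simp: ideal_module_simps a_ac)
  then show ?thesis
    by (rule moduleI[OF is_cring])
       (auto simp: ideal_module_simps l_distr r_distr m_assoc)
qed

lemma finsum_regular: "finsum (regular_module R) f S = finsum R f S"
  by (simp add: finsum_def finprod_def ideal_module_def)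

lemma ideal_regular_submodule:
  assumes "cring R" "ideal I R" shows "submodule I R (regular_module R)"
proof -
  interpret cring R by fact
  interpret Q: Module.module R "regular_module R" by (rule regular_module_module[OF assms(1)])
  interpret I: ideal I R by fact
  have neg: "\<ominus>\<^bsub>regular_module R\<^esub> x = \<ominus>\<^bsub>R\<^esub> x" if "x \<in> carrier R" for x
    using Q.minus_equality[of "\<ominus>\<^bsub>R\<^esub> x" x] that by (simp add: ideal_module_simps l_neg)
  show ?thesis
    by (rule Q.submoduleI) (use I.a_Hcarr neg I.I_l_closed in \<open>auto simp: ideal_module_simps\<close>)
qed

lemma submodule_finsum:
  assumes "Module.module R M" "submodule H R M" "\<And>x. x \<in> S \<Longrightarrow> f x \<in> H"
  shows "finsum M f S \<in> H"
proof -
  interpret M: Module.module R M by fact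
  note H = submodule_subset[OF assms(2)]
  show ?thesis
  proof (cases "finite S")
    case True
    then show ?thesis using assms(3)
    proof (induction S rule: finite_induct)
      case empty
      then show ?case using submodule_zero[OF assms(2)] by simp
    next
      case (insert x S)
      then have "finsum M f (insert x S) = f x \<oplus>\<^bsub>M\<^esub> finsum M f S"
        using H by (intro M.finsum_insert) auto
      then show ?case using insert submodule_add[OF assms(2)] by auto
    qed
  next
    case False
    then show ?thesis using submodule_zero[OF assms(2)] by (simp add: M.finsum_infinite)
  qed
qed

definition monomial_value :: "('a, 'r) ring_scheme \<Rightarrow> 'a multiset \<Rightarrow> 'a"
  where "monomial_value R m = (\<Otimes>\<^bsub>R\<^esub>x\<in>set_mset m. x [^]\<^bsub>R\<^esub> count m x)"

lemma monomial_value_closed: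
  assumes "cring R" "set_mset m \<subseteq> carrier R"
  shows "monomial_value R m \<in> carrier R"
proof -
  interpret cring R by fact
  show ?thesis
    unfolding monomial_value_def using assms(2) by (intro finprod_closed) auto
qed

lemma monomial_value_single:
  assumes "cring R" "x \<in> carrier R"
  shows "monomial_value R {#x#} = x"
proof -
  interpret cring R by fact
  show ?thesis using assms(2) by (simp add: monomial_value_def)
qed

lemma monomial_value_empty:
  assumes "cring R"
  shows "monomial_value R {#} = \<one>\<^bsub>R\<^esub>"
proof -
  interpret cring R by fact
  show ?thesis by (simp add: monomial_value_def)
qed

text \<open>The three products range over different sets of variables; extending all of them to the
  union only inserts factors with exponent zero.\<close>

lemma monomial_value_add:
  assumes "cring R" "set_mset k \<subseteq> carrier R" "set_mset l \<subseteq> carrier R"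
  shows "monomial_value R (k + l) = monomial_value R k \<otimes>\<^bsub>R\<^esub> monomial_value R l"
proof -
  interpret cring R by fact
  let ?S = "set_mset k \<union> set_mset l"
  have ext: "monomial_value R m = (\<Otimes>\<^bsub>R\<^esub>x\<in>?S. x [^]\<^bsub>R\<^esub> count m x)" if "set_mset m \<subseteq> ?S" for m
    unfolding monomial_value_def
    by (rule finprod_mono_neutral_cong_left)
       (use that assms(2,3) in \<open>auto simp: not_in_iff[THEN iffD1]\<close>)
  have "(\<Otimes>\<^bsub>R\<^esub>x\<in>?S. x [^]\<^bsub>R\<^esub> count (k + l) x)
      = (\<Otimes>\<^bsub>R\<^esub>x\<in>?S. x [^]\<^bsub>R\<^esub> count k x \<otimes>\<^bsub>R\<^esub> x [^]\<^bsub>R\<^esub> count l x)"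
    by (rule finprod_cong') (use assms(2,3) in \<open>auto simp: nat_pow_mult\<close>)
  also have "\<dots> = (\<Otimes>\<^bsub>R\<^esub>x\<in>?S. x [^]\<^bsub>R\<^esub> count k x) \<otimes>\<^bsub>R\<^esub> (\<Otimes>\<^bsub>R\<^esub>x\<in>?S. x [^]\<^bsub>R\<^esub> count l x)"
    by (rule finprod_multf) (use assms(2,3) in auto)
  finally show ?thesis by (simp add: ext)
qed

definition poly_eval :: "('a, 'r) ring_scheme \<Rightarrow> ('a multiset \<Rightarrow> 'a) \<Rightarrow> 'a"
  where "poly_eval R = lin_ext R (regular_module R) (monomial_value R)"

lemma sym_eval_eq: "sym_eval R Z = the_elem (poly_eval R ` Z)"
  by (simp add: sym_eval_def poly_eval_def lin_ext_def monomial_value_def ideal_module_simps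
      finsum_regular)

lemma ideal_pow_0: "I [^]\<^bsub>ideals_set R\<^esub> (0::nat) = carrier R"
  by (simp add: ideals_set_def)

lemma ideal_pow_Suc: "I [^]\<^bsub>ideals_set R\<^esub> Suc n = (I [^]\<^bsub>ideals_set R\<^esub> n) \<cdot>\<^bsub>R\<^esub> I"
  by (simp add: ideals_set_def)

lemma ideal_pow_ideal:
  assumes "cring R" "ideal I R"
  shows "ideal (I [^]\<^bsub>ideals_set R\<^esub> (n::nat)) R"
proof -
  interpret cring R by fact
  show ?thesis
  proof (induction n)
    case 0
    show ?case unfolding ideal_pow_0 by (rule oneideal)
  next
    case (Suc n)
    then show ?case unfolding ideal_pow_Suc by (rule ideal_prod_is_ideal[OF _ assms(2)])
  qed
qed

lemma monomial_value_in_power: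
  assumes "cring R" "ideal I R" "set_mset m \<subseteq> I"
  shows "monomial_value R m \<in> I [^]\<^bsub>ideals_set R\<^esub> size m"
  using assms(3)
proof (induction m)
  case empty
  interpret cring R by fact
  show ?case using monomial_value_empty[OF assms(1)] ideal_pow_0[where R = R and I = I] by (simp del: nat_pow_0)
next
  case (add x m)
  interpret cring R by fact
  have c: "set_mset m \<subseteq> carrier R" "x \<in> carrier R"
    using add.prems ideal.Icarr[OF assms(2)] by auto
  have "monomial_value R (m + {#x#}) = monomial_value R m \<otimes>\<^bsub>R\<^esub> x"
    using c monomial_value_add[OF assms(1) c(1), of "{#x#}"] monomial_value_single[OF assms(1)] by simp
  also have "\<dots> \<in> (I [^]\<^bsub>ideals_set R\<^esub> size m) \<cdot>\<^bsub>R\<^esub> I"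
    by (rule ideal_prod.prod) (use add in auto)
  finally show ?case unfolding ideal_pow_Suc[symmetric] by simp
qed

definition homog :: "('a, 'r) ring_scheme \<Rightarrow> 'x set \<Rightarrow> nat \<Rightarrow> ('x multiset \<Rightarrow> 'a) set"
  where "homog R X n =
    {p \<in> carrier (poly_algebra R X). \<forall>m. p m \<noteq> \<zero>\<^bsub>R\<^esub> \<longrightarrow> size m = n}"

section \<open>The symmetric algebra of an ideal\<close>

context
  fixes R :: "('a, 'r) ring_scheme" and I :: "'a set"
  assumes R: "cring R" and I: "ideal I R"
begin

interpretation R: cring R by (rule R)
interpretation I: ideal I R by (rule I)

abbreviation (input) "polyI \<equiv> poly_algebra R I"
abbreviation (input) "symJ \<equiv> sym_ideal R (ideal_module R I)"
abbreviation (input) "symS \<equiv> sym_algebra R (ideal_module R I)"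
abbreviation (input) "symD \<equiv> sym_degree R (ideal_module R I)"

interpretation P: cring polyI by (rule poly_cring[OF R])
interpretation PM: Module.module R polyI by (rule poly_module[OF R])

lemma monomial_carrier: "m \<in> monomials I \<Longrightarrow> set_mset m \<subseteq> carrier R"
  using I.Icarr by auto

lemma poly_eval_hom: "poly_eval R \<in> mod_hom R polyI (regular_module R)"
  unfolding poly_eval_def mod_hom_poly[OF R]
  by (rule lin_ext_hom[OF regular_module_module[OF R]])
     (simp add: ideal_module_simps monomial_value_closed[OF R] monomial_carrier)

lemma poly_eval_closed: "p \<in> carrier polyI \<Longrightarrow> poly_eval R p \<in> carrier R"
  using mod_hom_closed[OF poly_eval_hom] by (simp add: ideal_module_simps)

lemma poly_eval_monomial: "set_mset m \<subseteq> I \<Longrightarrow> poly_eval R (free_gen R m) = monomial_value R m"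
  unfolding poly_eval_def
  by (rule lin_ext_gen[OF regular_module_module[OF R]])
     (simp add: ideal_module_simps monomial_value_closed[OF R] monomial_carrier)

lemma regular_mult_hom:
  assumes "a \<in> carrier R"
  shows "(\<lambda>x. a \<otimes>\<^bsub>R\<^esub> x) \<in> mod_hom R (regular_module R) (regular_module R)"
    and "(\<lambda>x. x \<otimes>\<^bsub>R\<^esub> a) \<in> mod_hom R (regular_module R) (regular_module R)"
  by (rule mod_homI; use assms in \<open>simp add: ideal_module_simps R.r_distr R.l_distr R.m_ac\<close>)+

text \<open>Both sides are linear in \<open>p\<close> and in \<open>q\<close>, so monomials suffice.\<close>

lemma poly_eval_mult:
  assumes p: "p \<in> carrier polyI" and q: "q \<in> carrier polyI"
  shows "poly_eval R (p \<otimes>\<^bsub>polyI\<^esub> q) = poly_eval R p \<otimes>\<^bsub>R\<^esub> poly_eval R q"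
proof (rule poly_hom_eqI[OF R regular_module_module[OF R] mod_hom_comp[OF mult_hom_l[OF R q] poly_eval_hom]
        mod_hom_comp[OF poly_eval_hom regular_mult_hom(2)[OF poly_eval_closed[OF q]]] _ p])
  fix k assume k: "set_mset k \<subseteq> I"
  note kc = monomial_closed[OF R k]
  show "poly_eval R (free_gen R k \<otimes>\<^bsub>polyI\<^esub> q) = poly_eval R (free_gen R k) \<otimes>\<^bsub>R\<^esub> poly_eval R q"
  proof (rule poly_hom_eqI[OF R regular_module_module[OF R] mod_hom_comp[OF mult_hom_r[OF R kc] poly_eval_hom]
        mod_hom_comp[OF poly_eval_hom regular_mult_hom(1)[OF poly_eval_closed[OF kc]]] _ q])
    fix l assume l: "set_mset l \<subseteq> I"
    show "poly_eval R (free_gen R k \<otimes>\<^bsub>polyI\<^esub> free_gen R l)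
        = poly_eval R (free_gen R k) \<otimes>\<^bsub>R\<^esub> poly_eval R (free_gen R l)"
      using k l by (simp add: monomial_mult[OF R] poly_eval_monomial monomial_value_add[OF R] monomial_carrier)
  qed
qed

lemma sym_rels_subset: "sym_rels R (ideal_module R I) \<subseteq> carrier polyI"
proof -
  have "free_gen R {#x#} \<in> carrier polyI" if "x \<in> I" for x
    by (rule monomial_closed[OF R]) (use that in simp)
  then show ?thesis
    unfolding sym_rels_def Let_def ideal_module_simps by (auto simp: I.I_l_closed)
qed

lemma sym_ideal_ideal: "ideal symJ polyI"
  unfolding sym_ideal_def ideal_module_simps by (rule P.genideal_ideal[OF sym_rels_subset])

lemma sym_ideal_submodule: "submodule symJ R polyI"
  by (rule poly_ideal_submodule[OF R sym_ideal_ideal])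

lemma sym_algebra_eq: "symS = fact_module polyI symJ"
  by (simp add: sym_algebra_def ideal_module_simps)

lemma sym_algebra_module: "Module.module R symS"
  unfolding sym_algebra_eq by (rule fact_module_module[OF poly_module[OF R] sym_ideal_submodule])

text \<open>The zeros of the multiplicative linear map \<^const>\<open>poly_eval\<close> form an ideal, and the
  relations lie in it because evaluation sends the variable of \<open>x\<close> to \<open>x\<close> itself.\<close>

lemma poly_eval_sym_ideal:
  assumes "p \<in> symJ" shows "poly_eval R p = \<zero>\<^bsub>R\<^esub>"
proof -
  note hom = poly_eval_hom and mods = poly_module[OF R] regular_module_module[OF R]
  have T: "free_gen R {#x#} \<in> carrier polyI" "poly_eval R (free_gen R {#x#}) = x" if "x \<in> I" for x
    using that monomial_closed[OF R, of "{#x#}" I] poly_eval_monomial[of "{#x#}"]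
      monomial_value_single[OF R] I.Icarr by auto
  have sub: "submodule {p \<in> carrier polyI. poly_eval R p \<in> {\<zero>\<^bsub>regular_module R\<^esub>}} R polyI"
    by (rule submodule_vimage[OF mods hom submodule_zero_set[OF mods(2)]])
  let ?K = "{p \<in> carrier polyI. poly_eval R p \<in> {\<zero>\<^bsub>regular_module R\<^esub>}}"
  have "ideal ?K polyI"
    by (rule idealI[OF P.ring_axioms submodule.axioms(1)[OF sub]])
       (auto simp: poly_eval_mult ideal_module_simps poly_eval_closed)
  moreover have "sym_rels R (ideal_module R I) \<subseteq> ?K"
  proof -
    have "x \<ominus>\<^bsub>regular_module R\<^esub> x = \<zero>\<^bsub>regular_module R\<^esub>" if "x \<in> carrier R" for x
      using module_minus_eq_zero_iff[OF mods(2)] that by (simp add: ideal_module_simps)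
    then show ?thesis
      using sym_rels_subset
      by (auto simp: sym_rels_def Let_def ideal_module_simps mod_hom_minus[OF mods hom]
          mod_hom_add[OF hom] mod_hom_smult[OF hom] T I.I_l_closed I.Icarr)
  qed
  ultimately have "symJ \<subseteq> ?K"
    unfolding sym_ideal_def ideal_module_simps by (rule P.genideal_minimal)
  then show ?thesis using assms by (auto simp: ideal_module_simps)
qed

lemma sym_eval_coset: "p \<in> carrier polyI \<Longrightarrow> sym_eval R (symJ +>\<^bsub>polyI\<^esub> p) = poly_eval R p"
  and sym_eval_hom: "sym_eval R \<in> mod_hom R symS (regular_module R)"
proof -
  have z: "poly_eval R x = \<zero>\<^bsub>regular_module R\<^esub>" if "x \<in> symJ" for x
    using poly_eval_sym_ideal[OF that] by (simp add: ideal_module_simps)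
  note * = mod_hom_fact[OF poly_module[OF R] sym_ideal_submodule regular_module_module[OF R]
      poly_eval_hom z]
  show "p \<in> carrier polyI \<Longrightarrow> sym_eval R (symJ +>\<^bsub>polyI\<^esub> p) = poly_eval R p"
    using *(1) by (simp add: sym_eval_eq)
  show "sym_eval R \<in> mod_hom R symS (regular_module R)"
    using *(2) by (simp add: sym_eval_eq[abs_def] sym_algebra_eq)
qed

lemma homog_submodule: "submodule (homog R I n) R polyI"
proof -
  have neg: "(\<ominus>\<^bsub>polyI\<^esub> p) m = \<ominus>\<^bsub>R\<^esub> p m" if p: "p \<in> carrier polyI" for p m
  proof -
    have "\<ominus>\<^bsub>polyI\<^esub> p = \<ominus>\<^bsub>polyI\<^esub> (\<one>\<^bsub>R\<^esub> \<odot>\<^bsub>polyI\<^esub> p)" using p by simp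
    also have "\<dots> = (\<ominus>\<^bsub>R\<^esub> \<one>\<^bsub>R\<^esub>) \<odot>\<^bsub>polyI\<^esub> p" using p by (simp add: PM.smult_l_minus)
    finally have "(\<ominus>\<^bsub>polyI\<^esub> p) m = ((\<ominus>\<^bsub>R\<^esub> \<one>\<^bsub>R\<^esub>) \<odot>\<^bsub>polyI\<^esub> p) m" by simp
    also have "\<dots> = \<ominus>\<^bsub>R\<^esub> p m"
      using p free_carrierD(1)[of p R "monomials I" m]
      by (simp add: poly_simps free_module_simps R.l_minus)
    finally show ?thesis .
  qed
  show ?thesis
  proof (rule PM.submoduleI)
    show "homog R I n \<subseteq> carrier polyI" by (auto simp: homog_def)
    show "\<zero>\<^bsub>polyI\<^esub> \<in> homog R I n"
      using P.zero_closed by (simp add: homog_def) (simp add: poly_simps free_module_simps)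
  next
    fix p assume p: "p \<in> homog R I n"
    then have "p \<in> carrier polyI" by (simp add: homog_def)
    then show "\<ominus>\<^bsub>polyI\<^esub> p \<in> homog R I n"
      using p by (simp add: homog_def neg) (metis R.minus_zero)
  next
    fix p q assume pq: "p \<in> homog R I n" "q \<in> homog R I n"
    have "size m = n" if "(p \<oplus>\<^bsub>polyI\<^esub> q) m \<noteq> \<zero>\<^bsub>R\<^esub>" for m
    proof -
      have "p m \<noteq> \<zero>\<^bsub>R\<^esub> \<or> q m \<noteq> \<zero>\<^bsub>R\<^esub>"
        using that by (auto simp: poly_simps free_module_simps)
      then show ?thesis using pq by (auto simp: homog_def)
    qed
    then show "p \<oplus>\<^bsub>polyI\<^esub> q \<in> homog R I n" using pq by (simp add: homog_def)
  next
    fix a p assume a: "a \<in> carrier R" and p: "p \<in> homog R I n"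
    have "size m = n" if "(a \<odot>\<^bsub>polyI\<^esub> p) m \<noteq> \<zero>\<^bsub>R\<^esub>" for m
    proof -
      have "p m \<noteq> \<zero>\<^bsub>R\<^esub>"
        using that a by (auto simp: poly_simps free_module_simps)
      then show ?thesis using p by (auto simp: homog_def)
    qed
    then show "a \<odot>\<^bsub>polyI\<^esub> p \<in> homog R I n" using a p by (simp add: homog_def)
  qed
qed

lemma homog_monomial: "set_mset m \<subseteq> I \<Longrightarrow> free_gen R m \<in> homog R I (size m)"
  using monomial_closed[OF R, of m I] by (auto simp: homog_def free_gen_def)

text \<open>If \<open>m\<close> occurs in the product, then \<open>m = i + j\<close> with \<open>i\<close> and \<open>j\<close> occurring in the
  factors, and sizes of multisets add.\<close>

lemma homog_mult:
  assumes "p \<in> homog R I k" "q \<in> homog R I l"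
  shows "p \<otimes>\<^bsub>polyI\<^esub> q \<in> homog R I (k + l)"
proof -
  have pq: "p \<in> carrier polyI" "q \<in> carrier polyI" using assms by (auto simp: homog_def)
  have "size m = k + l" if nz: "(p \<otimes>\<^bsub>polyI\<^esub> q) m \<noteq> \<zero>\<^bsub>R\<^esub>" for m
  proof (rule poly_mult_nonzeroE[OF R pq nz])
    fix i j assume "m = i + j" "p i \<noteq> \<zero>\<^bsub>R\<^esub>" "q j \<noteq> \<zero>\<^bsub>R\<^esub>"
    then show "size m = k + l" using assms by (auto simp: homog_def)
  qed
  then show ?thesis using pq by (simp add: homog_def)
qed

text \<open>Each term is a multiple of a product of \<open>n\<close> elements of \<open>I\<close>.\<close>

lemma poly_eval_homog:
  assumes "p \<in> homog R I n" shows "poly_eval R p \<in> I [^]\<^bsub>ideals_set R\<^esub> n"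
proof -
  have p: "p \<in> carrier polyI" "\<And>m. p m \<noteq> \<zero>\<^bsub>R\<^esub> \<Longrightarrow> size m = n" using assms by (auto simp: homog_def)
  have sub: "{m. p m \<noteq> \<zero>\<^bsub>R\<^esub>} \<subseteq> monomials I" and c: "\<And>m. p m \<in> carrier R"
    using p(1) free_carrierD[of p R "monomials I"] by (simp_all add: poly_simps)
  have In: "ideal (I [^]\<^bsub>ideals_set R\<^esub> n) R" by (rule ideal_pow_ideal[OF R I])
  have "p m \<otimes>\<^bsub>R\<^esub> monomial_value R m \<in> I [^]\<^bsub>ideals_set R\<^esub> n" if m: "p m \<noteq> \<zero>\<^bsub>R\<^esub>" for m
    using monomial_value_in_power[OF R I, of m] sub p(2)[OF m] m
    by (intro ideal.I_l_closed[OF In _ c]) auto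
  then show ?thesis
    unfolding poly_eval_def lin_ext_def
    by (intro submodule_finsum[OF regular_module_module[OF R] ideal_regular_submodule[OF R In]])
       (simp add: ideal_module_simps)
qed

lemma sym_degree_carrier: "carrier (symD n) = (\<lambda>p. symJ +>\<^bsub>polyI\<^esub> p) ` homog R I n"
  by (auto simp: sym_degree_def homog_def ideal_module_simps)

lemma sym_degree_eq: "symD n = symS\<lparr>carrier := carrier (symD n)\<rparr>"
  by (simp add: sym_degree_def)

lemma sym_degree_submodule: "submodule (carrier (symD n)) R symS"
proof -
  have c: "(\<lambda>p. symJ +>\<^bsub>polyI\<^esub> p) \<in> mod_hom R polyI symS"
    unfolding sym_algebra_eq by (rule coset_mod_hom[OF poly_module[OF R] sym_ideal_submodule])
  show ?thesis
    unfolding sym_degree_carrier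
    by (rule submodule_image[OF poly_module[OF R] sym_algebra_module c homog_submodule])
qed

lemma sym_degree_module: "Module.module R (symD n)"
  by (subst sym_degree_eq)
     (rule submodule.submodule_is_module[OF sym_degree_submodule sym_algebra_module])

lemma sym_degree_ops:
  "add (symD n) = add symS" "smult (symD n) = smult symS"
  by (simp_all add: sym_degree_def)

lemma sym_degreeE:
  assumes "s \<in> carrier (symD n)"
  obtains p where "p \<in> homog R I n" "p \<in> carrier polyI" "s = symJ +>\<^bsub>polyI\<^esub> p"
  using assms unfolding sym_degree_carrier by (auto simp: homog_def)

lemma sym_degree_in_algebra: "s \<in> carrier (symD n) \<Longrightarrow> s \<in> carrier symS"
  using submodule_subset[OF sym_degree_submodule] by auto

lemma sym_mult_coset:
  assumes "p \<in> carrier polyI" "q \<in> carrier polyI"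
  shows "(symJ +>\<^bsub>polyI\<^esub> p) \<otimes>\<^bsub>symS\<^esub> (symJ +>\<^bsub>polyI\<^esub> q) = symJ +>\<^bsub>polyI\<^esub> (p \<otimes>\<^bsub>polyI\<^esub> q)"
  unfolding sym_algebra_eq fact_module_simps by (rule ideal.rcoset_mult_add[OF sym_ideal_ideal assms])

lemma sym_mult_bilinear: "bilinear R symS symS symS (mult symS)"
proof -
  note pm = poly_module[OF R] and b = poly_mult_bilinear[OF R, of I]
  note cos = coset_add[OF poly_module[OF R] sym_ideal_submodule, folded sym_algebra_eq]
    coset_smult[OF poly_module[OF R] sym_ideal_submodule, folded sym_algebra_eq]
    coset_closed[of _ polyI symJ, folded sym_algebra_eq]
  have E: "\<exists>p\<in>carrier polyI. s = symJ +>\<^bsub>polyI\<^esub> p" if "s \<in> carrier symS" for s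
    using that unfolding sym_algebra_eq by (elim fact_module_carrierE) auto
  show ?thesis
  proof (rule bilinearI, goal_cases)
    case (1 s t)
    then obtain p q where "p \<in> carrier polyI" "q \<in> carrier polyI"
      "s = symJ +>\<^bsub>polyI\<^esub> p" "t = symJ +>\<^bsub>polyI\<^esub> q" using E by metis
    then show ?case by (simp add: sym_mult_coset cos)
  next
    case (2 s s' t)
    then obtain p p' q where "p \<in> carrier polyI" "p' \<in> carrier polyI" "q \<in> carrier polyI"
      "s = symJ +>\<^bsub>polyI\<^esub> p" "s' = symJ +>\<^bsub>polyI\<^esub> p'" "t = symJ +>\<^bsub>polyI\<^esub> q" using E by metis
    then show ?case by (simp add: sym_mult_coset cos bilinearD[OF b])
  next
    case (3 s t t')
    then obtain p q q' where "p \<in> carrier polyI" "q \<in> carrier polyI" "q' \<in> carrier polyI"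
      "s = symJ +>\<^bsub>polyI\<^esub> p" "t = symJ +>\<^bsub>polyI\<^esub> q" "t' = symJ +>\<^bsub>polyI\<^esub> q'" using E by metis
    then show ?case by (simp add: sym_mult_coset cos bilinearD[OF b])
  next
    case (4 a s t)
    then obtain p q where "p \<in> carrier polyI" "q \<in> carrier polyI"
      "s = symJ +>\<^bsub>polyI\<^esub> p" "t = symJ +>\<^bsub>polyI\<^esub> q" using E by metis
    then show ?case using 4(1) by (simp add: sym_mult_coset cos bilinearD[OF b])
  next
    case (5 a s t)
    then obtain p q where "p \<in> carrier polyI" "q \<in> carrier polyI"
      "s = symJ +>\<^bsub>polyI\<^esub> p" "t = symJ +>\<^bsub>polyI\<^esub> q" using E by metis
    then show ?case using 5(1) by (simp add: sym_mult_coset cos bilinearD[OF b])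
  qed
qed

lemma sym_mult_degree:
  assumes "s \<in> carrier (symD k)" "t \<in> carrier (symD l)"
  shows "s \<otimes>\<^bsub>symS\<^esub> t \<in> carrier (symD (k + l))"
proof -
  obtain p q where pq: "p \<in> homog R I k" "p \<in> carrier polyI" "s = symJ +>\<^bsub>polyI\<^esub> p"
    "q \<in> homog R I l" "q \<in> carrier polyI" "t = symJ +>\<^bsub>polyI\<^esub> q"
    using assms by (elim sym_degreeE) blast
  show ?thesis
    unfolding sym_degree_carrier
    by (rule image_eqI[OF _ homog_mult[OF pq(1,4)]]) (simp add: pq sym_mult_coset)
qed

lemma sym_eval_mult:
  assumes "s \<in> carrier (symD k)" "t \<in> carrier (symD l)"
  shows "sym_eval R (s \<otimes>\<^bsub>symS\<^esub> t) = sym_eval R s \<otimes>\<^bsub>R\<^esub> sym_eval R t"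
proof -
  obtain p q where "p \<in> homog R I k" "p \<in> carrier polyI" "s = symJ +>\<^bsub>polyI\<^esub> p"
    "q \<in> homog R I l" "q \<in> carrier polyI" "t = symJ +>\<^bsub>polyI\<^esub> q"
    using assms by (elim sym_degreeE) blast
  then show ?thesis by (simp add: sym_mult_coset sym_eval_coset poly_eval_mult)
qed

lemma sym_eval_in_power: "s \<in> carrier (symD n) \<Longrightarrow> sym_eval R s \<in> I [^]\<^bsub>ideals_set R\<^esub> n"
  by (elim sym_degreeE) (simp add: sym_eval_coset poly_eval_homog)

lemma sym_eval_add:
  assumes "s \<in> carrier (symD n)" "t \<in> carrier (symD n)"
  shows "sym_eval R (s \<oplus>\<^bsub>symD n\<^esub> t) = sym_eval R s \<oplus>\<^bsub>R\<^esub> sym_eval R t"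
  using mod_hom_add[OF sym_eval_hom] assms sym_degree_in_algebra
  by (simp add: sym_degree_ops ideal_module_simps)

lemma sym_eval_smult:
  assumes "a \<in> carrier R" "s \<in> carrier (symD n)"
  shows "sym_eval R (a \<odot>\<^bsub>symD n\<^esub> s) = a \<otimes>\<^bsub>R\<^esub> sym_eval R s"
  using mod_hom_smult[OF sym_eval_hom] assms sym_degree_in_algebra
  by (simp add: sym_degree_ops ideal_module_simps)

text \<open>Elements of \<open>I\<^sup>n\<^sup>+\<^sup>1 = I\<^sup>n I\<close> are sums of products \<open>i j\<close>; preimages of \<open>i\<close> in degree \<open>n\<close>
  and of \<open>j\<close> in degree one multiply to a preimage of \<open>i j\<close> in degree \<open>n + 1\<close>.\<close>

lemma sym_eval_surj: "a \<in> I [^]\<^bsub>ideals_set R\<^esub> n \<Longrightarrow> \<exists>s\<in>carrier (symD n). sym_eval R s = a"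
proof (induction n arbitrary: a)
  case 0
  then have a: "a \<in> carrier R" unfolding ideal_pow_0 .
  have one: "free_gen R {#} \<in> homog R I 0" using homog_monomial[of "{#}"] by simp
  then have onec: "free_gen R {#} \<in> carrier polyI" by (simp add: homog_def)
  have "poly_eval R (a \<odot>\<^bsub>polyI\<^esub> free_gen R {#}) = a"
    using a mod_hom_smult[OF poly_eval_hom a onec] poly_eval_monomial[of "{#}"] monomial_value_empty[OF R]
    by (simp add: ideal_module_simps)
  moreover have "a \<odot>\<^bsub>polyI\<^esub> free_gen R {#} \<in> homog R I 0"
    by (rule submodule.smult_closed[OF homog_submodule a one])
  ultimately show ?case
    using a onec unfolding sym_degree_carrier bex_simps
    by (intro bexI[of _ "a \<odot>\<^bsub>polyI\<^esub> free_gen R {#}"]) (simp_all add: sym_eval_coset)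
next
  case (Suc n)
  have lin: "\<exists>s\<in>carrier (symD 1). sym_eval R s = x" if x: "x \<in> I" for x
  proof -
    have h: "free_gen R {#x#} \<in> homog R I 1" using homog_monomial[of "{#x#}"] x by simp
    then have "free_gen R {#x#} \<in> carrier polyI" by (simp add: homog_def)
    then have "sym_eval R (symJ +>\<^bsub>polyI\<^esub> free_gen R {#x#}) = x"
      using x poly_eval_monomial[of "{#x#}"] monomial_value_single[OF R] I.Icarr
      by (simp add: sym_eval_coset)
    then show ?thesis using h by (auto simp: sym_degree_carrier)
  qed
  from Suc.prems show ?case
    unfolding ideal_pow_Suc
  proof (induction rule: ideal_prod.induct)
    case (prod i j)
    then obtain s t where st: "s \<in> carrier (symD n)" "sym_eval R s = i"
      "t \<in> carrier (symD 1)" "sym_eval R t = j" using Suc.IH lin by blast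
    show ?case
      using sym_mult_degree[OF st(1,3)] sym_eval_mult[OF st(1,3)] st(2,4) by auto
  next
    case (sum s1 s2)
    then obtain s t where st: "s \<in> carrier (symD (Suc n))" "sym_eval R s = s1"
      "t \<in> carrier (symD (Suc n))" "sym_eval R t = s2" by blast
    interpret D: Module.module R "symD (Suc n)" by (rule sym_degree_module)
    show ?case using sym_eval_add[OF st(1,3)] st D.add.m_closed by auto
  qed
qed

end

section \<open>Products of ideals and modules\<close>

lemma smult_hom:
  assumes "Module.module R M" "a \<in> carrier R"
  shows "(\<lambda>x. a \<odot>\<^bsub>M\<^esub> x) \<in> mod_hom R M M"
proof -
  interpret M: Module.module R M by fact
  show ?thesis
    by (rule mod_homI)
       (use assms(2) in \<open>simp_all add: M.smult_r_distr M.smult_assoc1[symmetric] M.m_comm\<close>)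
qed

context
  fixes R :: "('a, 'r) ring_scheme" and M :: "('a, 'm, 'd) module_scheme"
  assumes M: "Module.module R M"
begin

interpretation M: Module.module R M by (rule M)

lemma ideal_smult_submodule:
  assumes "J \<subseteq> carrier R" "Y \<subseteq> carrier M"
  shows "submodule (ideal_smult R M J Y) R M"
  unfolding ideal_smult_def
  by (rule submodule_gen_submodule[OF M]) (use assms in auto)

lemma ideal_smult_memI: "a \<in> J \<Longrightarrow> y \<in> Y \<Longrightarrow> a \<odot>\<^bsub>M\<^esub> y \<in> ideal_smult R M J Y"
  unfolding ideal_smult_def by (rule subsetD[OF submodule_gen_incl]) auto

lemma ideal_smult_minimal:
  assumes "submodule H R M" "\<And>a y. a \<in> J \<Longrightarrow> y \<in> Y \<Longrightarrow> a \<odot>\<^bsub>M\<^esub> y \<in> H"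
  shows "ideal_smult R M J Y \<subseteq> H"
  unfolding ideal_smult_def by (rule submodule_gen_minimal[OF assms(1)]) (use assms(2) in auto)

lemma ideal_smult_carrier:
  assumes "submodule Y R M" shows "ideal_smult R M (carrier R) Y = Y"
proof
  show "ideal_smult R M (carrier R) Y \<subseteq> Y"
    by (rule ideal_smult_minimal[OF assms submodule.smult_closed[OF assms]])
  show "Y \<subseteq> ideal_smult R M (carrier R) Y"
  proof
    fix y assume y: "y \<in> Y"
    then have "\<one>\<^bsub>R\<^esub> \<odot>\<^bsub>M\<^esub> y = y" using submodule_subset[OF assms] by auto
    then show "y \<in> ideal_smult R M (carrier R) Y"
      using ideal_smult_memI[OF M.one_closed y] by simp
  qed
qed

lemma ideal_smult_prod:
  assumes I: "ideal I R" and J: "ideal J R" and Y: "Y \<subseteq> carrier M"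
  shows "ideal_smult R M (I \<cdot>\<^bsub>R\<^esub> J) Y = ideal_smult R M I (ideal_smult R M J Y)"
proof
  have Ic: "I \<subseteq> carrier R" and Jc: "J \<subseteq> carrier R"
    using ideal.Icarr[OF I] ideal.Icarr[OF J] by auto
  have IJc: "I \<cdot>\<^bsub>R\<^esub> J \<subseteq> carrier R"
    by (rule M.ideal_prod_in_carrier[OF I J])
  have JY: "submodule (ideal_smult R M J Y) R M" by (rule ideal_smult_submodule[OF Jc Y])
  have IJY: "submodule (ideal_smult R M I (ideal_smult R M J Y)) R M"
    by (rule ideal_smult_submodule[OF Ic submodule_subset[OF JY]])
  show "ideal_smult R M (I \<cdot>\<^bsub>R\<^esub> J) Y \<subseteq> ideal_smult R M I (ideal_smult R M J Y)"
  proof (rule ideal_smult_minimal[OF IJY])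
    fix a y assume "a \<in> I \<cdot>\<^bsub>R\<^esub> J" and y: "y \<in> Y"
    then show "a \<odot>\<^bsub>M\<^esub> y \<in> ideal_smult R M I (ideal_smult R M J Y)"
    proof (induction rule: ideal_prod.induct)
      case (prod i j)
      then have "(i \<otimes>\<^bsub>R\<^esub> j) \<odot>\<^bsub>M\<^esub> y = i \<odot>\<^bsub>M\<^esub> (j \<odot>\<^bsub>M\<^esub> y)"
        using Ic Jc Y by (auto intro: M.smult_assoc1)
      then show ?case using prod by (auto intro!: ideal_smult_memI)
    next
      case (sum a b)
      then have "(a \<oplus>\<^bsub>R\<^esub> b) \<odot>\<^bsub>M\<^esub> y = a \<odot>\<^bsub>M\<^esub> y \<oplus>\<^bsub>M\<^esub> b \<odot>\<^bsub>M\<^esub> y"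
        using IJc Y by (auto intro: M.smult_l_distr)
      then show ?case using submodule_add[OF IJY] sum y by auto
    qed
  qed
  have H: "submodule (ideal_smult R M (I \<cdot>\<^bsub>R\<^esub> J) Y) R M" by (rule ideal_smult_submodule[OF IJc Y])
  show "ideal_smult R M I (ideal_smult R M J Y) \<subseteq> ideal_smult R M (I \<cdot>\<^bsub>R\<^esub> J) Y"
  proof (rule ideal_smult_minimal[OF H])
    fix a z assume a: "a \<in> I" and z: "z \<in> ideal_smult R M J Y"
    have ac: "a \<in> carrier R" using a Ic by auto
    \<comment> \<open>for fixed \<open>a\<close> the elements \<open>z\<close> with \<open>a z\<close> in the target form a submodule, so generators suffice\<close>
    have "ideal_smult R M J Y \<subseteq> {z \<in> carrier M. a \<odot>\<^bsub>M\<^esub> z \<in> ideal_smult R M (I \<cdot>\<^bsub>R\<^esub> J) Y}"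
    proof (rule ideal_smult_minimal[OF submodule_vimage[OF M M smult_hom[OF M ac] H]])
      fix b y assume b: "b \<in> J" "y \<in> Y"
      then have "(a \<otimes>\<^bsub>R\<^esub> b) \<odot>\<^bsub>M\<^esub> y = a \<odot>\<^bsub>M\<^esub> (b \<odot>\<^bsub>M\<^esub> y)" "b \<odot>\<^bsub>M\<^esub> y \<in> carrier M"
        using ac Jc Y by (auto intro: M.smult_assoc1)
      then show "b \<odot>\<^bsub>M\<^esub> y \<in> {z \<in> carrier M. a \<odot>\<^bsub>M\<^esub> z \<in> ideal_smult R M (I \<cdot>\<^bsub>R\<^esub> J) Y}"
        using ideal_smult_memI[OF ideal_prod.prod[OF a b(1), of R] b(2)] by simp
    qed
    then show "a \<odot>\<^bsub>M\<^esub> z \<in> ideal_smult R M (I \<cdot>\<^bsub>R\<^esub> J) Y" using z by auto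
  qed
qed

end

context
  fixes R :: "('a, 'r) ring_scheme" and M :: "('a, 'm, 'd) module_scheme" and I
  assumes M: "Module.module R M" and I: "ideal I R"
begin

interpretation M: Module.module R M by (rule M)

lemma power_ideal: "ideal (I [^]\<^bsub>ideals_set R\<^esub> (n::nat)) R"
  by (rule ideal_pow_ideal[OF M.is_cring I])

lemma power_subset: "I [^]\<^bsub>ideals_set R\<^esub> (n::nat) \<subseteq> carrier R"
  using ideal.Icarr[OF power_ideal] by auto

lemma power_smult_submodule: "submodule (ideal_smult R M (I [^]\<^bsub>ideals_set R\<^esub> (n::nat)) (carrier M)) R M"
  by (rule ideal_smult_submodule[OF M power_subset order_refl])

lemma power_smult_Suc:
  assumes "Y \<subseteq> carrier M"
  shows "ideal_smult R M (I [^]\<^bsub>ideals_set R\<^esub> Suc n) Y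
    = ideal_smult R M I (ideal_smult R M (I [^]\<^bsub>ideals_set R\<^esub> n) Y)"
  unfolding ideal_pow_Suc M.ideal_prod_commute[OF power_ideal I]
  by (rule ideal_smult_prod[OF M I power_ideal assms])

end

section \<open>Traces of the adic filtration\<close>

text \<open>The trace on \<open>N\<close> of the \<open>I\<close>-adic filtration of \<open>M\<close>, that is \<open>I\<^sup>n M \<inter> N\<close>.\<close>

abbreviation (input) power_trace ::
    "('a, 'r) ring_scheme \<Rightarrow> 'm set \<Rightarrow> ('a, 'm, 'd) module_scheme \<Rightarrow> 'a set \<Rightarrow> nat \<Rightarrow> 'm set"
  where "power_trace R N M I n \<equiv> ideal_smult R M (I [^]\<^bsub>ideals_set R\<^esub> n) (carrier M) \<inter> N"

context
  fixes R :: "('a, 'r) ring_scheme" and M :: "('a, 'm, 'd) module_scheme" and N I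
  assumes M: "Module.module R M" and N: "submodule N R M" and I: "ideal I R"
begin

interpretation M: Module.module R M by (rule M)

lemma power_trace_submodule: "submodule (power_trace R N M I n) R M"
  by (rule submodule_inter[OF M power_smult_submodule[OF M I] N])

lemma power_trace_Suc_supset: "ideal_smult R M I (power_trace R N M I n) \<subseteq> power_trace R N M I (Suc n)"
proof (rule ideal_smult_minimal[OF M power_trace_submodule])
  fix a y assume a: "a \<in> I" and y: "y \<in> power_trace R N M I n"
  have "a \<odot>\<^bsub>M\<^esub> y \<in> N"
    by (rule submodule.smult_closed[OF N ideal.Icarr[OF I a]]) (use y in simp)
  moreover have "a \<odot>\<^bsub>M\<^esub> y \<in> ideal_smult R M (I [^]\<^bsub>ideals_set R\<^esub> Suc n) (carrier M)"
    unfolding power_smult_Suc[OF M I order_refl]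
    by (rule ideal_smult_memI[OF M a]) (use y in simp)
  ultimately show "a \<odot>\<^bsub>M\<^esub> y \<in> power_trace R N M I (Suc n)" by (rule IntI[rotated])
qed

text \<open>The condition defining the strong uniform number compares degree \<open>n\<close> with the fixed
  degree \<open>s\<close>. It is equivalent to a comparison of consecutive degrees, which is the one that matches
  the effective relations: a factor \<open>I\<close> can be split off \<open>I\<^sup>n\<^sup>+\<^sup>1\<^sup>-\<^sup>s\<close>, and conversely the one-step
  equalities multiply up. The one-step form also shows that the condition is inherited by larger
  \<open>s\<close>.\<close>

lemma power_trace_stable_iff:
  "(\<forall>n\<ge>s. power_trace R N M I n
      = ideal_smult R M (I [^]\<^bsub>ideals_set R\<^esub> (n - s)) (power_trace R N M I s))
    \<longleftrightarrow> (\<forall>n\<ge>s. power_trace R N M I (Suc n) = ideal_smult R M I (power_trace R N M I n))"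
    (is "?L \<longleftrightarrow> ?R")
proof
  have c: "power_trace R N M I s \<subseteq> carrier M" by (rule submodule_subset[OF power_trace_submodule])
  show ?R if L: ?L
  proof (intro allI impI)
    fix n assume n: "s \<le> n"
    have "power_trace R N M I (Suc n)
        = ideal_smult R M (I [^]\<^bsub>ideals_set R\<^esub> (Suc n - s)) (power_trace R N M I s)"
      by (rule L[rule_format, OF le_SucI[OF n]])
    also have "\<dots> = ideal_smult R M I
        (ideal_smult R M (I [^]\<^bsub>ideals_set R\<^esub> (n - s)) (power_trace R N M I s))"
      unfolding Suc_diff_le[OF n] by (rule power_smult_Suc[OF M I c])
    also have "\<dots> = ideal_smult R M I (power_trace R N M I n)"
      by (rule arg_cong[OF L[rule_format, OF n, symmetric]])
    finally show "power_trace R N M I (Suc n) = ideal_smult R M I (power_trace R N M I n)" .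
  qed
  show ?L if Rr: ?R
  proof (intro allI impI)
    fix n assume "s \<le> n"
    then show "power_trace R N M I n
      = ideal_smult R M (I [^]\<^bsub>ideals_set R\<^esub> (n - s)) (power_trace R N M I s)"
    proof (induction n rule: dec_induct)
      case base
      show ?case
        unfolding diff_self_eq_0 ideal_pow_0
        by (rule ideal_smult_carrier[OF M power_trace_submodule, symmetric])
    next
      case (step n)
      have "power_trace R N M I (Suc n) = ideal_smult R M I (power_trace R N M I n)"
        by (rule Rr[rule_format, OF step.hyps(1)])
      also have "\<dots> = ideal_smult R M I
          (ideal_smult R M (I [^]\<^bsub>ideals_set R\<^esub> (n - s)) (power_trace R N M I s))"
        by (rule arg_cong[OF step.IH])
      also have "\<dots> = ideal_smult R M (I [^]\<^bsub>ideals_set R\<^esub> (Suc n - s)) (power_trace R N M I s)"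
        unfolding Suc_diff_le[OF step.hyps(1)] by (rule power_smult_Suc[OF M I c, symmetric])
      finally show ?case .
    qed
  qed
qed

end

section \<open>The canonical map onto the Rees module\<close>

context
  fixes R :: "('a, 'r) ring_scheme" and I :: "'a set" and M :: "('a, 'm, 'd) module_scheme"
  assumes I: "ideal I R" and M: "Module.module R M"
begin

interpretation M: Module.module R M by (rule M)


lemmas symD_module = sym_degree_module[OF M.is_cring I]

lemma sym_tensor_module: "Module.module R (sym_tensor R I M n)"
  unfolding sym_tensor_def by (rule tensor_module[OF symD_module M])

lemma rees_module: "Module.module R (rees R I M n)"
  unfolding rees_def
  by (rule submodule.submodule_is_module[OF power_smult_submodule[OF M I] M])

lemma sym_eval_carrier: "s \<in> carrier (symD R I n) \<Longrightarrow> sym_eval R s \<in> carrier R"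
  using sym_eval_in_power[OF M.is_cring I] power_subset[OF M I] by auto

lemma rees_map_bilinear:
  "bilinear R (symD R I n) M (rees R I M n) (\<lambda>s y. sym_eval R s \<odot>\<^bsub>M\<^esub> y)"
proof (rule bilinearI, goal_cases)
  case (1 s y)
  then show ?case
    using ideal_smult_memI[OF M sym_eval_in_power[OF M.is_cring I 1(1)] 1(2)] by (simp add: rees_def)
next
  case (2 s s' y)
  then show ?case
    by (simp add: rees_def sym_eval_add[OF M.is_cring I] M.smult_l_distr sym_eval_carrier)
next
  case (3 s y y')
  then show ?case by (simp add: rees_def M.smult_r_distr sym_eval_carrier)
next
  case (4 a s y)
  then show ?case
    by (simp add: rees_def sym_eval_smult[OF M.is_cring I] M.smult_assoc1 sym_eval_carrier)
next
  case (5 a s y)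
  then show ?case
    by (simp add: rees_def M.smult_assoc1[symmetric] M.m_comm sym_eval_carrier)
qed

lemma rees_map_hom: "rees_map R I M n \<in> mod_hom R (sym_tensor R I M n) (rees R I M n)"
  unfolding rees_map_def sym_tensor_def
  by (rule tensor_lift_hom[OF symD_module M rees_module rees_map_bilinear])

text \<open>The components \<open>I\<^sup>n M\<close> carry the operations of \<open>M\<close>, so the maps \<open>\<gamma>\<^sub>n\<close> can all be taken
  with values in \<open>M\<close>, where different degrees are comparable.\<close>

lemma rees_map_hom_module: "rees_map R I M n \<in> mod_hom R (sym_tensor R I M n) M"
  using subsetD[OF submodule_subset[OF power_smult_submodule[OF M I, of n]]] rees_map_hom[of n]
  by (simp add: mod_hom_def rees_def Pi_iff)

lemma rees_map_in: "z \<in> carrier (sym_tensor R I M n) \<Longrightarrow>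
    rees_map R I M n z \<in> ideal_smult R M (I [^]\<^bsub>ideals_set R\<^esub> n) (carrier M)"
  using mod_hom_closed[OF rees_map_hom] by (simp add: rees_def)

lemma rees_map_pure:
  "s \<in> carrier (symD R I n) \<Longrightarrow> y \<in> carrier M \<Longrightarrow>
    rees_map R I M n (pure_tensor R (symD R I n) M s y) = sym_eval R s \<odot>\<^bsub>M\<^esub> y"
  unfolding rees_map_def by (rule tensor_lift_pure[OF symD_module M rees_module rees_map_bilinear])

lemma pure_bilinear: "bilinear R (symD R I n) M (sym_tensor R I M n) (pure_tensor R (symD R I n) M)"
  unfolding sym_tensor_def by (rule pure_tensor_bilinear[OF symD_module M])

text \<open>The image is a submodule, and it contains \<open>a y\<close> for \<open>a \<in> I\<^sup>n\<close> because every such \<open>a\<close> is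
  the value of an element of \<open>S\<^sub>n(I)\<close>.\<close>

lemma rees_map_surj:
  assumes "x \<in> ideal_smult R M (I [^]\<^bsub>ideals_set R\<^esub> n) (carrier M)"
  obtains z where "z \<in> carrier (sym_tensor R I M n)" "rees_map R I M n z = x"
proof -
  interpret T: Module.module R "sym_tensor R I M n" by (rule sym_tensor_module)
  let ?H = "rees_map R I M n ` carrier (sym_tensor R I M n)"
  have "ideal_smult R M (I [^]\<^bsub>ideals_set R\<^esub> n) (carrier M) \<subseteq> ?H"
  proof (rule ideal_smult_minimal[OF M submodule_image[OF sym_tensor_module M rees_map_hom_module
          T.carrier_is_submodule]])
    fix a y assume "a \<in> I [^]\<^bsub>ideals_set R\<^esub> n" and y: "y \<in> carrier M"
    then obtain s where s: "s \<in> carrier (symD R I n)" "sym_eval R s = a"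
      using sym_eval_surj[OF M.is_cring I] by blast
    show "a \<odot>\<^bsub>M\<^esub> y \<in> ?H"
      by (rule image_eqI[OF _ bilinearD(1)[OF pure_bilinear s(1) y]])
         (simp add: rees_map_pure[OF s(1) y] s(2))
  qed
  then show thesis using assms that by auto
qed

lemma sym_act_bilinear:
  assumes s: "s \<in> carrier (symD R I 1)"
  shows "bilinear R (symD R I n) M (sym_tensor R I M (Suc n))
    (\<lambda>t y. pure_tensor R (symD R I (Suc n)) M (s \<otimes>\<^bsub>sym_algebra R (ideal_module R I)\<^esub> t) y)"
proof -
  note S = M.is_cring I
  have c: "s \<otimes>\<^bsub>sym_algebra R (ideal_module R I)\<^esub> t \<in> carrier (symD R I (Suc n))"
    if "t \<in> carrier (symD R I n)" for t
    using sym_mult_degree[OF S s that] by simp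
  note b = bilinearD[OF pure_bilinear[of "Suc n"]]
  note m = bilinearD[OF sym_mult_bilinear[OF S]] sym_degree_in_algebra[OF S]
  have add: "s \<otimes>\<^bsub>sym_algebra R (ideal_module R I)\<^esub> (t \<oplus>\<^bsub>symD R I n\<^esub> t')
      = (s \<otimes>\<^bsub>sym_algebra R (ideal_module R I)\<^esub> t) \<oplus>\<^bsub>symD R I (Suc n)\<^esub>
        (s \<otimes>\<^bsub>sym_algebra R (ideal_module R I)\<^esub> t')"
    if "t \<in> carrier (symD R I n)" "t' \<in> carrier (symD R I n)" for t t'
    using that s by (simp add: sym_degree_ops[OF S] m)
  have smult: "s \<otimes>\<^bsub>sym_algebra R (ideal_module R I)\<^esub> (a \<odot>\<^bsub>symD R I n\<^esub> t)
      = a \<odot>\<^bsub>symD R I (Suc n)\<^esub> (s \<otimes>\<^bsub>sym_algebra R (ideal_module R I)\<^esub> t)"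
    if "a \<in> carrier R" "t \<in> carrier (symD R I n)" for a t
    using that s by (simp add: sym_degree_ops[OF S] m)
  show ?thesis
    by (rule bilinearI) (simp_all add: add smult c b)
qed

lemma sym_act_hom:
  "s \<in> carrier (symD R I 1) \<Longrightarrow>
    sym_act R I M n s \<in> mod_hom R (sym_tensor R I M n) (sym_tensor R I M (Suc n))"
  unfolding sym_act_def
  by (subst (2) sym_tensor_def)
     (rule tensor_lift_hom[OF symD_module M sym_tensor_module sym_act_bilinear])

lemma sym_act_pure:
  "s \<in> carrier (symD R I 1) \<Longrightarrow> t \<in> carrier (symD R I n) \<Longrightarrow> y \<in> carrier M \<Longrightarrow>
    sym_act R I M n s (pure_tensor R (symD R I n) M t y)
      = pure_tensor R (symD R I (Suc n)) M (s \<otimes>\<^bsub>sym_algebra R (ideal_module R I)\<^esub> t) y"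
  unfolding sym_act_def
  by (rule tensor_lift_pure[OF symD_module M sym_tensor_module sym_act_bilinear])

lemma sym_tensor_hom_eqI:
  assumes "Module.module R Q"
    and "g \<in> mod_hom R (sym_tensor R I M n) Q" "h \<in> mod_hom R (sym_tensor R I M n) Q"
    and "\<And>s y. s \<in> carrier (symD R I n) \<Longrightarrow> y \<in> carrier M \<Longrightarrow>
      g (pure_tensor R (symD R I n) M s y) = h (pure_tensor R (symD R I n) M s y)"
    and "z \<in> carrier (sym_tensor R I M n)"
  shows "g z = h z"
  using assms(2-5) unfolding sym_tensor_def
  by (rule tensor_hom_eqI[OF symD_module M assms(1)])

text \<open>Multiplication by \<open>s\<close> on the source of \<open>\<gamma>\<close> becomes multiplication by the value of \<open>s\<close> on
  the target; it suffices to compare on pure tensors.\<close>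

lemma rees_map_sym_act:
  assumes s: "s \<in> carrier (symD R I 1)" and z: "z \<in> carrier (sym_tensor R I M n)"
  shows "rees_map R I M (Suc n) (sym_act R I M n s z) = sym_eval R s \<odot>\<^bsub>M\<^esub> rees_map R I M n z"
proof (rule sym_tensor_hom_eqI[OF M mod_hom_comp[OF sym_act_hom[OF s] rees_map_hom_module]
      mod_hom_comp[OF rees_map_hom_module smult_hom[OF M sym_eval_carrier[OF s]]] _ z])
  fix t y assume t: "t \<in> carrier (symD R I n)" and y: "y \<in> carrier M"
  note S = M.is_cring I
  have st: "s \<otimes>\<^bsub>sym_algebra R (ideal_module R I)\<^esub> t \<in> carrier (symD R I (Suc n))"
    using sym_mult_degree[OF S s t] by simp
  show "rees_map R I M (Suc n) (sym_act R I M n s (pure_tensor R (symD R I n) M t y))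
      = sym_eval R s \<odot>\<^bsub>M\<^esub> rees_map R I M n (pure_tensor R (symD R I n) M t y)"
    unfolding sym_act_pure[OF s t y] rees_map_pure[OF st y] rees_map_pure[OF t y]
      sym_eval_mult[OF S s t]
    by (rule M.smult_assoc1[OF sym_eval_carrier[OF s] sym_eval_carrier[OF t] y])
qed

lemma rees_ker_iff:
  "z \<in> rees_ker R I M n \<longleftrightarrow> z \<in> carrier (sym_tensor R I M n) \<and> rees_map R I M n z = \<zero>\<^bsub>M\<^esub>"
  by (simp add: rees_ker_def a_kernel_def' rees_def)

lemma rees_ker_submodule: "submodule (rees_ker R I M n) R (sym_tensor R I M n)"
proof -
  have "rees_ker R I M n = {z \<in> carrier (sym_tensor R I M n). rees_map R I M n z \<in> {\<zero>\<^bsub>M\<^esub>}}"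
    using rees_ker_iff by auto
  then show ?thesis
    using submodule_vimage[OF sym_tensor_module M rees_map_hom_module submodule_zero_set[OF M]] by simp
qed

text \<open>Generators of \<open>S\<^sub>1(I) \<cdot> ker \<gamma>\<^sub>n\<close>, a submodule of degree \<open>n + 1\<close>.\<close>

definition ker_products :: "nat \<Rightarrow> (('a multiset \<Rightarrow> 'a) set \<times> 'm \<Rightarrow> 'a) set set"
  where "ker_products n = {sym_act R I M n s z | s z.
    s \<in> carrier (symD R I 1) \<and> z \<in> rees_ker R I M n}"

lemma sym_act_rees_ker:
  assumes "s \<in> carrier (symD R I 1)" "z \<in> rees_ker R I M n"
  shows "sym_act R I M n s z \<in> rees_ker R I M (Suc n)"
  using assms rees_map_sym_act[OF assms(1)] mod_hom_closed[OF sym_act_hom[OF assms(1)]]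
    sym_eval_carrier[OF assms(1)]
  by (simp add: rees_ker_iff)

lemma ker_products_subset: "ker_products n \<subseteq> rees_ker R I M (Suc n)"
  unfolding ker_products_def using sym_act_rees_ker by auto

lemma ker_products_gen_submodule:
  "submodule (submodule_gen R (sym_tensor R I M (Suc n)) (ker_products n)) R (sym_tensor R I M (Suc n))"
  by (rule submodule_gen_submodule[OF sym_tensor_module])
     (use ker_products_subset submodule_subset[OF rees_ker_submodule] in blast)

lemma effective_relations_trivial_iff:
  "carrier (effective_relations R I M (Suc n)) = {\<zero>\<^bsub>effective_relations R I M (Suc n)\<^esub>}
    \<longleftrightarrow> rees_ker R I M (Suc n) \<subseteq> submodule_gen R (sym_tensor R I M (Suc n)) (ker_products n)"
proof -
  have "submodule_gen R (sym_tensor R I M (Suc n)) (ker_products n) \<subseteq> rees_ker R I M (Suc n)"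
    by (rule submodule_gen_minimal[OF rees_ker_submodule ker_products_subset])
  then have "submodule (submodule_gen R (sym_tensor R I M (Suc n)) (ker_products n)) R
      (sym_tensor R I M (Suc n)\<lparr>carrier := rees_ker R I M (Suc n)\<rparr>)"
    by (rule submodule_restrict[OF sym_tensor_module rees_ker_submodule ker_products_gen_submodule])
  from fact_module_trivial_iff[OF submodule.submodule_is_module[OF rees_ker_submodule
        sym_tensor_module] this]
  show ?thesis by (simp add: effective_relations_def ker_products_def)
qed

end

section \<open>Passing to a quotient module\<close>

context
  fixes R :: "('a, 'r) ring_scheme" and I :: "'a set" and M :: "('a, 'm, 'd) module_scheme" and N
  assumes I: "ideal I R" and M: "Module.module R M" and N: "submodule N R M"
begin

interpretation M: Module.module R M by (rule M)

abbreviation (input) "MN \<equiv> fact_module M N"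

lemmas MN_module = fact_module_module[OF M N]

text \<open>The map \<open>S\<^sub>n(I) \<otimes> M \<rightarrow> S\<^sub>n(I) \<otimes> M/N\<close> induced by the projection, called \<open>\<pi>\<^sub>n\<close> below.\<close>

definition sym_tensor_proj ::
    "nat \<Rightarrow> (('a multiset \<Rightarrow> 'a) set \<times> 'm \<Rightarrow> 'a) set \<Rightarrow> (('a multiset \<Rightarrow> 'a) set \<times> 'm set \<Rightarrow> 'a) set"
  where "sym_tensor_proj n = tensor_lift R (sym_tensor R I MN n)
    (\<lambda>s y. pure_tensor R (symD R I n) MN s (N +>\<^bsub>M\<^esub> y))"

lemma sym_tensor_proj_bilinear:
  "bilinear R (symD R I n) M (sym_tensor R I MN n)
    (\<lambda>s y. pure_tensor R (symD R I n) MN s (N +>\<^bsub>M\<^esub> y))"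
  by (rule bilinearI)
     (simp_all add: bilinearD[OF pure_bilinear[OF I MN_module]] coset_closed
        coset_add[OF M N, symmetric] coset_smult[OF M N, symmetric])

lemma sym_tensor_proj_hom:
  "sym_tensor_proj n \<in> mod_hom R (sym_tensor R I M n) (sym_tensor R I MN n)"
  unfolding sym_tensor_proj_def
  by (subst sym_tensor_def)
     (rule tensor_lift_hom[OF sym_degree_module[OF M.is_cring I] M
        sym_tensor_module[OF I MN_module] sym_tensor_proj_bilinear])

lemma sym_tensor_proj_pure:
  "s \<in> carrier (symD R I n) \<Longrightarrow> y \<in> carrier M \<Longrightarrow>
    sym_tensor_proj n (pure_tensor R (symD R I n) M s y)
      = pure_tensor R (symD R I n) MN s (N +>\<^bsub>M\<^esub> y)"
  unfolding sym_tensor_proj_def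
  by (rule tensor_lift_pure[OF sym_degree_module[OF M.is_cring I] M
        sym_tensor_module[OF I MN_module] sym_tensor_proj_bilinear])

lemma sym_tensor_proj_surj:
  assumes "z \<in> carrier (sym_tensor R I MN n)"
  obtains x where "x \<in> carrier (sym_tensor R I M n)" "sym_tensor_proj n x = z"
proof -
  interpret T: Module.module R "sym_tensor R I M n" by (rule sym_tensor_module[OF I M])
  let ?H = "sym_tensor_proj n ` carrier (sym_tensor R I M n)"
  have H: "submodule ?H R (sym_tensor R I MN n)"
    by (rule submodule_image[OF sym_tensor_module[OF I M] sym_tensor_module[OF I MN_module]
          sym_tensor_proj_hom T.carrier_is_submodule])
  have "carrier (sym_tensor R I MN n) \<subseteq> ?H"
    using H unfolding sym_tensor_def[of R I MN]
  proof (rule tensor_span[OF sym_degree_module[OF M.is_cring I] MN_module])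
    fix s Y assume s: "s \<in> carrier (symD R I n)" and "Y \<in> carrier MN"
    then obtain y where y: "y \<in> carrier M" "Y = N +>\<^bsub>M\<^esub> y" by (elim fact_module_carrierE)
    show "pure_tensor R (symD R I n) MN s Y \<in> ?H"
      by (rule image_eqI[OF _ bilinearD(1)[OF pure_bilinear[OF I M] s y(1)]])
         (simp add: sym_tensor_proj_pure[OF s y(1)] y(2))
  qed
  then show thesis using assms that by auto
qed

lemma rees_map_proj:
  assumes "z \<in> carrier (sym_tensor R I M n)"
  shows "rees_map R I MN n (sym_tensor_proj n z) = N +>\<^bsub>M\<^esub> rees_map R I M n z"
proof (rule sym_tensor_hom_eqI[OF I M MN_module
      mod_hom_comp[OF sym_tensor_proj_hom rees_map_hom_module[OF I MN_module]]
      mod_hom_comp[OF rees_map_hom_module[OF I M] coset_mod_hom[OF M N]] _ assms])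
  fix s y assume s: "s \<in> carrier (symD R I n)" and y: "y \<in> carrier M"
  show "rees_map R I MN n (sym_tensor_proj n (pure_tensor R (symD R I n) M s y))
      = N +>\<^bsub>M\<^esub> rees_map R I M n (pure_tensor R (symD R I n) M s y)"
    unfolding sym_tensor_proj_pure[OF s y] rees_map_pure[OF I M s y]
      rees_map_pure[OF I MN_module s coset_closed[OF y]]
    by (rule coset_smult[OF M N sym_eval_carrier[OF I M s] y])
qed

text \<open>The bridge between the two invariants: since \<open>\<gamma>(\<pi> z)\<close> is the class of \<open>\<gamma>(z)\<close> modulo \<open>N\<close>,
  the relations of \<open>M/N\<close> are the projections of those \<open>z\<close> whose value lies in the trace
  \<open>I\<^sup>n M \<inter> N\<close>.\<close>

lemma rees_ker_proj_iff:
  assumes "z \<in> carrier (sym_tensor R I M n)"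
  shows "sym_tensor_proj n z \<in> rees_ker R I MN n \<longleftrightarrow> rees_map R I M n z \<in> N"
proof -
  have "sym_tensor_proj n z \<in> rees_ker R I MN n \<longleftrightarrow> N +>\<^bsub>M\<^esub> rees_map R I M n z = N"
    using mod_hom_closed[OF sym_tensor_proj_hom assms]
    by (simp add: rees_ker_iff[OF I MN_module] rees_map_proj[OF assms] fact_module_simps)
  also have "\<dots> \<longleftrightarrow> rees_map R I M n z \<in> N"
    by (rule coset_eq_self_iff[OF M N mod_hom_closed[OF rees_map_hom_module[OF I M] assms]])
  finally show ?thesis .
qed

lemma sym_act_proj:
  assumes s: "s \<in> carrier (symD R I 1)" and z: "z \<in> carrier (sym_tensor R I M n)"
  shows "sym_tensor_proj (Suc n) (sym_act R I M n s z) = sym_act R I MN n s (sym_tensor_proj n z)"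
proof (rule sym_tensor_hom_eqI[OF I M sym_tensor_module[OF I MN_module]
      mod_hom_comp[OF sym_act_hom[OF I M s] sym_tensor_proj_hom]
      mod_hom_comp[OF sym_tensor_proj_hom sym_act_hom[OF I MN_module s]] _ z])
  fix t y assume t: "t \<in> carrier (symD R I n)" and y: "y \<in> carrier M"
  have st: "s \<otimes>\<^bsub>sym_algebra R (ideal_module R I)\<^esub> t \<in> carrier (symD R I (Suc n))"
    using sym_mult_degree[OF M.is_cring I s t] by simp
  show "sym_tensor_proj (Suc n) (sym_act R I M n s (pure_tensor R (symD R I n) M t y))
      = sym_act R I MN n s (sym_tensor_proj n (pure_tensor R (symD R I n) M t y))"
    unfolding sym_act_pure[OF I M s t y] sym_tensor_proj_pure[OF t y] sym_tensor_proj_pure[OF st y]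
      sym_act_pure[OF I MN_module s t coset_closed[OF y]] by (rule refl)
qed

text \<open>For \<open>s\<close> in degree \<open>n\<close> the class of \<open>s y\<close> modulo \<open>P \<supseteq> I\<^sup>n N\<close> depends only on \<open>y\<close> modulo
  \<open>N\<close>, so \<open>\<gamma>\<^sub>n\<close> modulo \<open>P\<close> factors through \<open>\<pi>\<^sub>n\<close>. The factorisation stands in for the description
  of the kernel of \<open>\<pi>\<^sub>n\<close> by right exactness of the tensor product: whatever \<open>\<pi>\<^sub>n\<close> forgets has its
  value in \<open>P\<close>.\<close>

lemma quotient_lift_exists:
  assumes P: "submodule P R M"
    and PN: "ideal_smult R M (I [^]\<^bsub>ideals_set R\<^esub> n) N \<subseteq> P"
  obtains h where "h \<in> mod_hom R (sym_tensor R I MN n) (fact_module M P)"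
    and "\<And>z. z \<in> carrier (sym_tensor R I M n) \<Longrightarrow>
      h (sym_tensor_proj n z) = P +>\<^bsub>M\<^esub> rees_map R I M n z"
proof -
  let ?b = "\<lambda>s Y. the_elem ((\<lambda>y. P +>\<^bsub>M\<^esub> (sym_eval R s \<odot>\<^bsub>M\<^esub> y)) ` Y)"
  note MP = fact_module_module[OF M P] and S = M.is_cring I
  have hs: "(\<lambda>y. P +>\<^bsub>M\<^esub> (sym_eval R s \<odot>\<^bsub>M\<^esub> y)) \<in> mod_hom R M (fact_module M P)"
    if "s \<in> carrier (symD R I n)" for s
    by (rule mod_hom_comp[OF smult_hom[OF M sym_eval_carrier[OF I M that]] coset_mod_hom[OF M P]])
  have kill: "P +>\<^bsub>M\<^esub> (sym_eval R s \<odot>\<^bsub>M\<^esub> y) = \<zero>\<^bsub>fact_module M P\<^esub>"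
    if s: "s \<in> carrier (symD R I n)" and y: "y \<in> N" for s y
  proof -
    have "sym_eval R s \<odot>\<^bsub>M\<^esub> y \<in> P"
      using ideal_smult_memI[OF M sym_eval_in_power[OF S s] y] PN by auto
    then show ?thesis
      using coset_eq_self_iff[OF M P] submodule_subset[OF P] by (auto simp: fact_module_simps)
  qed
  have b: "?b s (N +>\<^bsub>M\<^esub> y) = P +>\<^bsub>M\<^esub> (sym_eval R s \<odot>\<^bsub>M\<^esub> y)"
    if "s \<in> carrier (symD R I n)" "y \<in> carrier M" for s y
    by (rule mod_hom_fact_coset[OF M N MP hs[OF that(1)] kill[OF that(1)] that(2)])
  have bil: "bilinear R (symD R I n) MN (fact_module M P) ?b"
    unfolding bilinear_def
  proof (intro conjI ballI)
    show "?b s \<in> mod_hom R MN (fact_module M P)" if s: "s \<in> carrier (symD R I n)" for s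
      by (rule mod_hom_fact_hom[OF M N MP hs[OF s] kill[OF s]])
  next
    fix Y assume "Y \<in> carrier MN"
    then obtain y where y: "y \<in> carrier M" "Y = N +>\<^bsub>M\<^esub> y" by (elim fact_module_carrierE)
    interpret D: Module.module R "symD R I n" by (rule sym_degree_module[OF S])
    note e = sym_eval_carrier[OF I M]
    show "(\<lambda>s. ?b s Y) \<in> mod_hom R (symD R I n) (fact_module M P)"
      unfolding y(2)
    proof (rule mod_homI)
      fix s t assume s: "s \<in> carrier (symD R I n)" and t: "t \<in> carrier (symD R I n)"
      show "?b (s \<oplus>\<^bsub>symD R I n\<^esub> t) (N +>\<^bsub>M\<^esub> y)
          = ?b s (N +>\<^bsub>M\<^esub> y) \<oplus>\<^bsub>fact_module M P\<^esub> ?b t (N +>\<^bsub>M\<^esub> y)"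
        unfolding b[OF D.M.a_closed[OF s t] y(1)] b[OF s y(1)] b[OF t y(1)]
        using e s t y(1) by (simp add: coset_add[OF M P] sym_eval_add[OF S] M.smult_l_distr)
    next
      fix s assume s: "s \<in> carrier (symD R I n)"
      show "?b s (N +>\<^bsub>M\<^esub> y) \<in> carrier (fact_module M P)"
        unfolding b[OF s y(1)] using e s y(1) by (simp add: coset_closed)
      fix a assume a: "a \<in> carrier R"
      show "?b (a \<odot>\<^bsub>symD R I n\<^esub> s) (N +>\<^bsub>M\<^esub> y) = a \<odot>\<^bsub>fact_module M P\<^esub> ?b s (N +>\<^bsub>M\<^esub> y)"
        unfolding b[OF D.smult_closed[OF a s] y(1)] b[OF s y(1)]
        using a e s y(1) by (simp add: coset_smult[OF M P] sym_eval_smult[OF S] M.smult_assoc1)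
    qed
  qed
  note lift = tensor_lift_hom[OF sym_degree_module[OF S] MN_module MP bil, folded sym_tensor_def]
  show thesis
  proof (rule that[OF lift])
    fix z assume z: "z \<in> carrier (sym_tensor R I M n)"
    show "tensor_lift R (fact_module M P) ?b (sym_tensor_proj n z) = P +>\<^bsub>M\<^esub> rees_map R I M n z"
    proof (rule sym_tensor_hom_eqI[OF I M MP mod_hom_comp[OF sym_tensor_proj_hom lift]
          mod_hom_comp[OF rees_map_hom_module[OF I M] coset_mod_hom[OF M P]] _ z])
      fix s y assume s: "s \<in> carrier (symD R I n)" and y: "y \<in> carrier M"
      show "tensor_lift R (fact_module M P) ?b (sym_tensor_proj n (pure_tensor R (symD R I n) M s y))
          = P +>\<^bsub>M\<^esub> rees_map R I M n (pure_tensor R (symD R I n) M s y)"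
        unfolding sym_tensor_proj_pure[OF s y] rees_map_pure[OF I M s y]
          tensor_lift_pure[OF sym_degree_module[OF S] MN_module MP bil s coset_closed[OF y]]
        by (rule b[OF s y])
    qed
  qed
qed

text \<open>Take \<open>P = I (I\<^sup>n M \<inter> N)\<close>, which contains \<open>I\<^sup>n\<^sup>+\<^sup>1 N\<close>, and factor \<open>\<gamma>\<^sub>n\<^sub>+\<^sub>1\<close> modulo \<open>P\<close> through
  \<open>S\<^sub>n\<^sub>+\<^sub>1(I) \<otimes> M/N\<close>. A product of a degree one element with a relation of degree \<open>n\<close> lifts to an
  element with value in \<open>P\<close>, so the factored map kills it. If these products generate all relations
  of degree \<open>n + 1\<close>, the factored map kills all of them, and an element of \<open>I\<^sup>n\<^sup>+\<^sup>1 M \<inter> N\<close>, being the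
  value of a lift of such a relation, lies in \<open>P\<close>.\<close>

lemma power_trace_Suc_if_no_relations:
  assumes triv: "carrier (effective_relations R I MN (Suc n)) = {\<zero>\<^bsub>effective_relations R I MN (Suc n)\<^esub>}"
  shows "power_trace R N M I (Suc n) = ideal_smult R M I (power_trace R N M I n)"
proof
  let ?P = "ideal_smult R M I (power_trace R N M I n)"
  show "?P \<subseteq> power_trace R N M I (Suc n)" by (rule power_trace_Suc_supset[OF M N I])
  have Nc: "N \<subseteq> carrier M" by (rule submodule_subset[OF N])
  have P: "submodule ?P R M"
    by (rule ideal_smult_submodule[OF M _ submodule_subset[OF power_trace_submodule[OF M N I]]])
       (use ideal.Icarr[OF I] in auto)
  \<comment> \<open>the inclusion that makes the factorisation through \<open>M/N\<close> possible\<close>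
  have PN: "ideal_smult R M (I [^]\<^bsub>ideals_set R\<^esub> Suc n) N \<subseteq> ?P"
    unfolding power_smult_Suc[OF M I Nc]
  proof (rule ideal_smult_minimal[OF M P])
    fix a y assume a: "a \<in> I" and y: "y \<in> ideal_smult R M (I [^]\<^bsub>ideals_set R\<^esub> n) N"
    have "ideal_smult R M (I [^]\<^bsub>ideals_set R\<^esub> n) N \<subseteq> power_trace R N M I n"
    proof (rule ideal_smult_minimal[OF M power_trace_submodule[OF M N I]])
      fix b z assume bz: "b \<in> I [^]\<^bsub>ideals_set R\<^esub> n" "z \<in> N"
      have "b \<odot>\<^bsub>M\<^esub> z \<in> N"
        by (rule submodule.smult_closed[OF N subsetD[OF power_subset[OF M I] bz(1)] bz(2)])
      then show "b \<odot>\<^bsub>M\<^esub> z \<in> power_trace R N M I n"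
        using ideal_smult_memI[OF M bz(1) subsetD[OF Nc bz(2)]] by simp
    qed
    then show "a \<odot>\<^bsub>M\<^esub> y \<in> ?P" using y by (intro ideal_smult_memI[OF M a]) auto
  qed
  obtain h where h: "h \<in> mod_hom R (sym_tensor R I MN (Suc n)) (fact_module M ?P)"
    and hp: "\<And>z. z \<in> carrier (sym_tensor R I M (Suc n)) \<Longrightarrow>
      h (sym_tensor_proj (Suc n) z) = ?P +>\<^bsub>M\<^esub> rees_map R I M (Suc n) z"
    by (rule quotient_lift_exists[OF P PN]) blast
  note MP = fact_module_module[OF M P]
  let ?K = "{z \<in> carrier (sym_tensor R I MN (Suc n)). h z \<in> {\<zero>\<^bsub>fact_module M ?P\<^esub>}}"
  have "ker_products R I MN n \<subseteq> ?K"
  proof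
    fix w assume "w \<in> ker_products R I MN n"
    then obtain s z where s: "s \<in> carrier (symD R I 1)" and z: "z \<in> rees_ker R I MN n"
      and w: "w = sym_act R I MN n s z" unfolding ker_products_def[OF I MN_module] by auto
    have "z \<in> carrier (sym_tensor R I MN n)" using z rees_ker_iff[OF I MN_module] by auto
    then obtain x where x: "x \<in> carrier (sym_tensor R I M n)" "sym_tensor_proj n x = z"
      by (rule sym_tensor_proj_surj)
    have "rees_map R I M n x \<in> power_trace R N M I n"
      using rees_ker_proj_iff[OF x(1)] z x(2) rees_map_in[OF I M x(1)] by simp
    moreover have "sym_eval R s \<in> I"
    proof -
      have "sym_eval R s \<in> I [^]\<^bsub>ideals_set R\<^esub> Suc 0"
        using sym_eval_in_power[OF M.is_cring I s] by simp
      also have "I [^]\<^bsub>ideals_set R\<^esub> Suc 0 = carrier R \<cdot>\<^bsub>R\<^esub> I"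
        unfolding ideal_pow_Suc ideal_pow_0 ..
      also have "\<dots> \<subseteq> I" using M.ideal_prod_inter[OF M.oneideal I] by simp
      finally show ?thesis .
    qed
    ultimately have "sym_eval R s \<odot>\<^bsub>M\<^esub> rees_map R I M n x \<in> ?P" by (intro ideal_smult_memI[OF M])
    then have mem: "rees_map R I M (Suc n) (sym_act R I M n s x) \<in> ?P"
      by (simp only: rees_map_sym_act[OF I M s x(1)])
    have xs: "sym_act R I M n s x \<in> carrier (sym_tensor R I M (Suc n))"
      by (rule mod_hom_closed[OF sym_act_hom[OF I M s] x(1)])
    have "w = sym_tensor_proj (Suc n) (sym_act R I M n s x)"
      unfolding w sym_act_proj[OF s x(1)] x(2) ..
    then have "w \<in> carrier (sym_tensor R I MN (Suc n))"
      and "h w = ?P +>\<^bsub>M\<^esub> rees_map R I M (Suc n) (sym_act R I M n s x)"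
      using mod_hom_closed[OF sym_tensor_proj_hom xs] hp[OF xs] by simp_all
    then show "w \<in> ?K"
      using coset_eq_self_iff[OF M P subsetD[OF submodule_subset[OF P] mem]] mem
      by (simp add: fact_module_simps)
  qed
  then have K: "submodule_gen R (sym_tensor R I MN (Suc n)) (ker_products R I MN n) \<subseteq> ?K"
    by (intro submodule_gen_minimal
        submodule_vimage[OF sym_tensor_module[OF I MN_module] MP h submodule_zero_set[OF MP]])
  show "power_trace R N M I (Suc n) \<subseteq> ?P"
  proof
    fix x assume x: "x \<in> power_trace R N M I (Suc n)"
    then obtain z where z: "z \<in> carrier (sym_tensor R I M (Suc n))" "rees_map R I M (Suc n) z = x"
      by (elim IntE rees_map_surj[OF I M])
    have "sym_tensor_proj (Suc n) z \<in> rees_ker R I MN (Suc n)"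
      using rees_ker_proj_iff[OF z(1)] z(2) x by simp
    then have "sym_tensor_proj (Suc n) z \<in> ?K"
      using triv[unfolded effective_relations_trivial_iff[OF I MN_module]] K by blast
    then have "?P +>\<^bsub>M\<^esub> x = ?P"
      using hp[OF z(1)] z(2) by (simp add: fact_module_simps)
    then show "x \<in> ?P"
      using coset_eq_self_iff[OF M P] x Nc by blast
  qed
qed

text \<open>Lift a relation \<open>w\<close> of \<open>M/N\<close> to some \<open>x\<close>. Its value lies in
  \<open>I\<^sup>n\<^sup>+\<^sup>1 M \<inter> N = I (I\<^sup>n M \<inter> N)\<close>, hence it is also the value of a sum \<open>y\<close> of products of degree one
  elements with elements that project to relations of \<open>M/N\<close>. Then \<open>x - y\<close> is a relation of \<open>M\<close>,
  therefore generated by relations of lower degree, and \<open>w = \<pi>(x - y) + \<pi>(y)\<close> is generated by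
  relations of \<open>M/N\<close> of lower degree.\<close>

lemma no_relations_quotient:
  assumes triv: "carrier (effective_relations R I M (Suc n)) = {\<zero>\<^bsub>effective_relations R I M (Suc n)\<^esub>}"
    and trace: "power_trace R N M I (Suc n) = ideal_smult R M I (power_trace R N M I n)"
  shows "carrier (effective_relations R I MN (Suc n)) = {\<zero>\<^bsub>effective_relations R I MN (Suc n)\<^esub>}"
  unfolding effective_relations_trivial_iff[OF I MN_module]
proof
  let ?T = "sym_tensor R I M (Suc n)" and ?T' = "sym_tensor R I MN (Suc n)"
  let ?G = "submodule_gen R ?T (ker_products R I M n)"
  let ?G' = "submodule_gen R ?T' (ker_products R I MN n)"
  let ?g = "rees_map R I M (Suc n)" and ?p = "sym_tensor_proj (Suc n)"
  note T = sym_tensor_module[OF I M] and T' = sym_tensor_module[OF I MN_module]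
  note G' = ker_products_gen_submodule[OF I MN_module, of n]
  note pre = submodule_vimage[OF T T' sym_tensor_proj_hom G']
  interpret T: Module.module R ?T by (rule T)
  interpret T': Module.module R ?T' by (rule T')
  have prod: "sym_act R I M n s z \<in> carrier ?T \<and> ?p (sym_act R I M n s z) \<in> ?G'"
    if s: "s \<in> carrier (symD R I 1)" and z: "z \<in> carrier (sym_tensor R I M n)"
      "sym_tensor_proj n z \<in> rees_ker R I MN n" for s z
  proof
    show "sym_act R I M n s z \<in> carrier ?T"
      by (rule mod_hom_closed[OF sym_act_hom[OF I M s] z(1)])
    show "?p (sym_act R I M n s z) \<in> ?G'"
      unfolding sym_act_proj[OF s z(1)]
      by (rule subsetD[OF submodule_gen_incl]) (use s z(2) in \<open>auto simp: ker_products_def[OF I MN_module]\<close>)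
  qed
  have "ker_products R I M n \<subseteq> {z \<in> carrier ?T. ?p z \<in> ?G'}"
  proof
    fix w assume "w \<in> ker_products R I M n"
    then obtain s z where s: "s \<in> carrier (symD R I 1)" and z: "z \<in> rees_ker R I M n"
      and w: "w = sym_act R I M n s z" unfolding ker_products_def[OF I M] by auto
    have zc: "z \<in> carrier (sym_tensor R I M n)" "rees_map R I M n z = \<zero>\<^bsub>M\<^esub>"
      using z rees_ker_iff[OF I M] by auto
    then have "sym_tensor_proj n z \<in> rees_ker R I MN n"
      using rees_ker_proj_iff[OF zc(1)] submodule_zero[OF N] by simp
    then show "w \<in> {z \<in> carrier ?T. ?p z \<in> ?G'}" using prod[OF s zc(1)] w by simp
  qed
  then have G: "?G \<subseteq> {z \<in> carrier ?T. ?p z \<in> ?G'}" by (rule submodule_gen_minimal[OF pre])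
  \<comment> \<open>the value of any lift of a relation of \<open>M/N\<close> is also taken by an element projecting into \<open>?G'\<close>\<close>
  have trace_sub: "power_trace R N M I (Suc n) \<subseteq> ?g ` {z \<in> carrier ?T. ?p z \<in> ?G'}"
    unfolding trace
  proof (rule ideal_smult_minimal[OF M submodule_image[OF T M rees_map_hom_module[OF I M] pre]])
    fix a y assume a: "a \<in> I" and y: "y \<in> power_trace R N M I n"
    obtain z where z: "z \<in> carrier (sym_tensor R I M n)" "rees_map R I M n z = y"
      using y by (elim IntE rees_map_surj[OF I M])
    have "a \<in> I [^]\<^bsub>ideals_set R\<^esub> (1::nat)"
    proof -
      have "\<one>\<^bsub>R\<^esub> \<otimes>\<^bsub>R\<^esub> a \<in> carrier R \<cdot>\<^bsub>R\<^esub> I" by (rule ideal_prod.prod[OF M.one_closed a])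
      then show ?thesis
        using ideal.Icarr[OF I a] unfolding One_nat_def ideal_pow_Suc ideal_pow_0 by simp
    qed
    then obtain s where s: "s \<in> carrier (symD R I 1)" "sym_eval R s = a"
      using sym_eval_surj[OF M.is_cring I] by blast
    have "sym_tensor_proj n z \<in> rees_ker R I MN n"
      using rees_ker_proj_iff[OF z(1)] z(2) y by simp
    then have "sym_act R I M n s z \<in> {z \<in> carrier ?T. ?p z \<in> ?G'}" using prod[OF s(1) z(1)] by simp
    then show "a \<odot>\<^bsub>M\<^esub> y \<in> ?g ` {z \<in> carrier ?T. ?p z \<in> ?G'}"
      by (rule image_eqI[rotated]) (simp only: rees_map_sym_act[OF I M s(1) z(1)] s(2) z(2))
  qed
  fix w assume w: "w \<in> rees_ker R I MN (Suc n)"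
  then have "w \<in> carrier ?T'" using rees_ker_iff[OF I MN_module] by auto
  then obtain x where x: "x \<in> carrier ?T" "?p x = w" by (rule sym_tensor_proj_surj)
  have "?g x \<in> power_trace R N M I (Suc n)"
    using rees_ker_proj_iff[OF x(1)] x(2) w rees_map_in[OF I M x(1)] by simp
  then obtain y where y: "y \<in> carrier ?T" "?p y \<in> ?G'" "?g y = ?g x" using trace_sub by auto
  have c: "x \<ominus>\<^bsub>?T\<^esub> y \<in> carrier ?T" using x(1) y(1) by (simp add: a_minus_def)
  have "?g (x \<ominus>\<^bsub>?T\<^esub> y) = \<zero>\<^bsub>M\<^esub>"
    unfolding mod_hom_minus[OF T M rees_map_hom_module[OF I M] x(1) y(1)] y(3)
    using module_minus_eq_zero_iff[OF M] mod_hom_closed[OF rees_map_hom_module[OF I M] x(1)] by blast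
  then have "x \<ominus>\<^bsub>?T\<^esub> y \<in> ?G"
    using c triv[unfolded effective_relations_trivial_iff[OF I M]] rees_ker_iff[OF I M] by blast
  then have "?p (x \<ominus>\<^bsub>?T\<^esub> y) \<in> ?G'" using G by blast
  then have diff: "w \<ominus>\<^bsub>?T'\<^esub> ?p y \<in> ?G'"
    unfolding mod_hom_minus[OF T T' sym_tensor_proj_hom x(1) y(1)] x(2) .
  have "w \<ominus>\<^bsub>?T'\<^esub> ?p y \<oplus>\<^bsub>?T'\<^esub> ?p y \<in> ?G'" by (rule submodule_add[OF G' diff y(2)])
  moreover have "w \<ominus>\<^bsub>?T'\<^esub> ?p y \<oplus>\<^bsub>?T'\<^esub> ?p y = w"
    using \<open>w \<in> carrier ?T'\<close> subsetD[OF submodule_subset[OF G'] y(2)]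
    by (simp add: a_minus_def T'.M.a_assoc T'.M.l_neg)
  ultimately show "w \<in> ?G'" by simp
qed

end

section \<open>The inequalities\<close>

text \<open>Bounds for the relation type and for the strong uniform number. In both the comparison
  is between degrees \<open>n\<close> and \<open>n + 1\<close> with \<open>n\<close> at least the bound, so the two conditions can be
  matched degree by degree.\<close>

definition relation_bound ::
    "('a, 'r) ring_scheme \<Rightarrow> 'a set \<Rightarrow> ('a, 'm, 'd) module_scheme \<Rightarrow> nat \<Rightarrow> bool"
  where "relation_bound R I M r \<longleftrightarrow> 1 \<le> r \<and>
    (\<forall>n\<ge>r. carrier (effective_relations R I M (Suc n)) = {\<zero>\<^bsub>effective_relations R I M (Suc n)\<^esub>})"

definition uniform_bound ::
    "('a, 'r) ring_scheme \<Rightarrow> 'm set \<Rightarrow> ('a, 'm, 'd) module_scheme \<Rightarrow> 'a set \<Rightarrow> nat \<Rightarrow> bool"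
  where "uniform_bound R N M I s \<longleftrightarrow> 1 \<le> s \<and>
    (\<forall>n\<ge>s. power_trace R N M I (Suc n) = ideal_smult R M I (power_trace R N M I n))"

lemma relation_type_eq: "relation_type R I M = (INF r\<in>{r. relation_bound R I M r}. enat r)"
proof -
  have *: "(\<forall>n\<ge>r + 1. P n) \<longleftrightarrow> (\<forall>n\<ge>r. P (Suc n))" for r and P :: "nat \<Rightarrow> bool"
    by (metis Suc_eq_plus1 Suc_le_D Suc_le_mono)
  show ?thesis unfolding relation_type_def relation_bound_def * ..
qed

text \<open>Since \<open>W\<close> is nonempty, the requirement \<open>1 \<le> s\<close> can be absorbed into the bounds for its
  members.\<close>

lemma strong_uniform_number_eq:
  assumes "Module.module R M" "submodule N R M" "W \<subseteq> {J. ideal J R}" "W \<noteq> {}"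
  shows "strong_uniform_number R N M W = (INF s\<in>{s. \<forall>J\<in>W. uniform_bound R N M J s}. enat s)"
proof -
  have "(1 \<le> s \<and> (\<forall>J\<in>W. \<forall>n\<ge>s. power_trace R N M J n
      = ideal_smult R M (J [^]\<^bsub>ideals_set R\<^esub> (n - s)) (power_trace R N M J s)))
    \<longleftrightarrow> (\<forall>J\<in>W. uniform_bound R N M J s)" for s
    using power_trace_stable_iff[OF assms(1,2)] assms(3,4) unfolding uniform_bound_def by blast
  then show ?thesis unfolding strong_uniform_number_def by simp
qed

lemma INF_enat_attained:
  assumes "(INF r\<in>S. enat r) \<le> enat k"
  obtains r where "r \<in> S" "r \<le> k"
proof -
  have "(INF r\<in>S. enat r) < enat (Suc k)" using assms by (simp add: le_less_trans)
  then show thesis using that by (auto simp: INF_less_iff)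
qed

lemma relation_bound_mono: "relation_bound R I M r \<Longrightarrow> r \<le> k \<Longrightarrow> relation_bound R I M k"
  by (auto simp: relation_bound_def)

lemma uniform_bound_mono: "uniform_bound R N M I r \<Longrightarrow> r \<le> k \<Longrightarrow> uniform_bound R N M I k"
  by (auto simp: uniform_bound_def)

lemma relation_type_le: "relation_type R I M \<le> enat k \<longleftrightarrow> relation_bound R I M k"
  unfolding relation_type_eq
  by (auto elim!: INF_enat_attained intro: INF_lower2 relation_bound_mono)

lemma strong_uniform_number_le:
  assumes "Module.module R M" "submodule N R M" "W \<subseteq> {J. ideal J R}" "W \<noteq> {}"
  shows "strong_uniform_number R N M W \<le> enat k \<longleftrightarrow> (\<forall>J\<in>W. uniform_bound R N M J k)"
  unfolding strong_uniform_number_eq[OF assms]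
  using uniform_bound_mono
  by (auto elim!: INF_enat_attained intro: INF_lower2) blast

text \<open>Inequalities between values that may be infinite are proved by comparing finite upper
  bounds.\<close>

lemma enat_leI:
  assumes "\<And>k. b \<le> enat k \<Longrightarrow> a \<le> enat k"
  shows "a \<le> (b::enat)"
  using assms by (cases b) auto

lemma uniform_bound_if_relation_bound:
  assumes "ideal I R" "Module.module R M" "submodule N R M"
    and r: "relation_bound R I (fact_module M N) k"
  shows "uniform_bound R N M I k"
  unfolding uniform_bound_def
proof (intro conjI allI impI)
  show "1 \<le> k" using r by (simp add: relation_bound_def)
  fix n assume "k \<le> n"
  then have "carrier (effective_relations R I (fact_module M N) (Suc n))
      = {\<zero>\<^bsub>effective_relations R I (fact_module M N) (Suc n)\<^esub>}"
    using r by (simp add: relation_bound_def)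
  then show "power_trace R N M I (Suc n) = ideal_smult R M I (power_trace R N M I n)"
    by (rule power_trace_Suc_if_no_relations[OF assms(1-3)])
qed

lemma relation_bound_quotient:
  assumes "ideal I R" "Module.module R M" "submodule N R M"
    and r: "relation_bound R I M k" and s: "uniform_bound R N M I k"
  shows "relation_bound R I (fact_module M N) k"
  unfolding relation_bound_def
proof (intro conjI allI impI)
  show "1 \<le> k" using r by (simp add: relation_bound_def)
  fix n assume n: "k \<le> n"
  have triv: "carrier (effective_relations R I M (Suc n)) = {\<zero>\<^bsub>effective_relations R I M (Suc n)\<^esub>}"
    using r n by (simp add: relation_bound_def)
  have "power_trace R N M I (Suc n) = ideal_smult R M I (power_trace R N M I n)"
    using s n unfolding uniform_bound_def by (elim conjE allE[of _ n] impE)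
  with triv show "carrier (effective_relations R I (fact_module M N) (Suc n))
      = {\<zero>\<^bsub>effective_relations R I (fact_module M N) (Suc n)\<^esub>}"
    by (rule no_relations_quotient[OF assms(1-3)])
qed

lemma strong_uniform_number_le_SUP:
  assumes "Module.module R M" "submodule N R M" "W \<subseteq> {J. ideal J R}" "W \<noteq> {}"
  shows "strong_uniform_number R N M W \<le> (SUP J\<in>W. relation_type R J (fact_module M N))"
proof (rule enat_leI)
  fix k assume "(SUP J\<in>W. relation_type R J (fact_module M N)) \<le> enat k"
  then have "\<forall>J\<in>W. relation_bound R J (fact_module M N) k"
    by (simp add: SUP_le_iff relation_type_le)
  then have "\<forall>J\<in>W. uniform_bound R N M J k"
    using uniform_bound_if_relation_bound[OF _ assms(1,2)] assms(3) by blast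
  then show "strong_uniform_number R N M W \<le> enat k"
    using strong_uniform_number_le[OF assms] by blast
qed

lemma relation_type_quotient_le:
  assumes "Module.module R M" "submodule N R M" "ideal I R"
  shows "relation_type R I (fact_module M N)
    \<le> max (relation_type R I M) (strong_uniform_number R N M {I})"
proof (rule enat_leI)
  fix k assume "max (relation_type R I M) (strong_uniform_number R N M {I}) \<le> enat k"
  then have "relation_bound R I M k" "uniform_bound R N M I k"
    using strong_uniform_number_le[OF assms(1,2), of "{I}"] assms(3)
    by (simp_all add: relation_type_le)
  then have "relation_bound R I (fact_module M N) k"
    by (rule relation_bound_quotient[OF assms(3,1,2)])
  then show "relation_type R I (fact_module M N) \<le> enat k"
    by (simp add: relation_type_le)
qed

theorem theorem2:
  fixes A :: "('a, 'r) ring_scheme"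
    and M :: "('a, 'm, 'd) module_scheme"
    and N :: "'m set"
    and W :: "'a set set"
    and I :: "'a set"
  assumes "cring A"
    and "Module.module A M"
    and "submodule N A M"
    and "W \<subseteq> {J. ideal J A}"
    and "I \<in> W"
  shows "strong_uniform_number A N M {I} \<le> relation_type A I (fact_module M N) \<and>
    relation_type A I (fact_module M N)
      \<le> max (relation_type A I M) (strong_uniform_number A N M {I}) \<and>
    strong_uniform_number A N M W \<le> (SUP J\<in>W. relation_type A J (fact_module M N)) \<and>
    strong_uniform_number_all A N M \<le> global_relation_type A (fact_module M N)"
proof (intro conjI)
  have I: "ideal I A" using assms(4,5) by auto
  note le = strong_uniform_number_le_SUP[OF assms(2,3)]
  show "strong_uniform_number A N M {I} \<le> relation_type A I (fact_module M N)"
    using le[of "{I}"] I by simp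
  show "relation_type A I (fact_module M N)
      \<le> max (relation_type A I M) (strong_uniform_number A N M {I})"
    by (rule relation_type_quotient_le[OF assms(2,3) I])
  show "strong_uniform_number A N M W \<le> (SUP J\<in>W. relation_type A J (fact_module M N))"
    using le[OF assms(4)] assms(5) by blast
  show "strong_uniform_number_all A N M \<le> global_relation_type A (fact_module M N)"
    unfolding strong_uniform_number_all_def global_relation_type_def
    using le[of "{J. ideal J A}"] I by blast
qed

end
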